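(* Let $h=(1,h_1,\dots,h_e)$ be the $h$-vector of a level algebra $A=R/I$ of type $2$ and socle degree $e$, and let $M\subseteq S$ be the Inverse System module associated to $A$ (so $I$ is the annihilator of $M$ in $R$). Then, for every choice of two forms $F$ and $G$ generating $M$, $h$ can be written as $$h=h'+h''+h''',$$ where $h''$ is an $O$-sequence, the reverses of $h'$ and $h'''$ are $O$-sequences, and $h'+h''$ and $h''+h'''$ are the Gorenstein $h$-vectors given by $\langle F\rangle$ and $\langle G\rangle$ respectively. Moreover, the three $O$-sequences (namely $h''$, the reverse of $h'$ and the reverse of $h'''$) are $h$-vectors of quotients of $A$.
   Context: Let $k$ be a field of characteristic zero and $R=k[x_1,\dots,x_r]$ with the standard grading. Algebras $A=R/I$ are standard graded artinian, with $I$ a homogeneous ideal. The $h$-vector of $A$ is $(h_0,h_1,\dots,h_e)$, $h_i=\dim_k A_i$, where $e$ (the socle degree) is the last index with $\dim_k A_e>0$; for the algebra $A$ itself one assumes $I$ contains no nonzero linear forms, so $h_1=r$ is the codimension. The socle of $A$ is the annihilator of the maximal homogeneous ideal of $A$, and $s_i=\dim_k \mathrm{soc}(A)_i$. $A$ is level of type $t$ if $s_i=0$ for $i<e$ and $s_e=t$; it is Gorenstein if it is level of type $1$. A Gorenstein $h$-vector is the $h$-vector of a Gorenstein algebra. Inverse Systems: let $S=k[y_1,\dots,y_r]$, viewed as a graded $R$-module with $x_i$ acting as $\partial/\partial y_i$. Artinian quotients $R/I$ correspond bijectively to finitely generated graded $R$-submodules $M\subseteq S$, where $I=M^{-1}$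 is the annihilator of $M$ in $R$, and $M$ is the submodule of $S$ of elements annihilated by $I$. Level algebras of type $t$ and socle degree $e$ correspond to $R$-submodules of $S$ minimally generated by $t$ forms of degree $e$. $\langle F\rangle$ denotes the $R$-submodule of $S$ generated by $F$, and the $h$-vector given by a module $N\subseteq S$ is the $h$-vector of $R/N^{-1}$; its entry in degree $i$ is $\dim_k N_i$. For positive integers $n,i$ write the unique $i$-binomial expansion $n=\binom{n_i}{i}+\binom{n_{i-1}}{i-1}+\dots+\binom{n_j}{j}$ with $n_i>n_{i-1}>\dots>n_j\ge j\ge 1$, and set $n^{<i>}=\binom{n_i+1}{i+1}+\binom{n_{i-1}+1}{i}+\dots+\binom{n_j+1}{j+1}$ (and $0^{<i>}=0$). An $O$-sequence is a sequence of non-negative integers $(v_0=1,v_1,v_2,\dots)$ with $v_{d+1}\le v_d^{<d>}$ for all $d\ge 1$. All vectors $h,h',h'',h'''$ are indexed by $0,\dots,e$ (trailing zeros are allowed when speaking of $O$-sequences and of $h$-vectors of quotients), and the reverse of $(v_0,\dots,v_e)$ is $(v_e,\dots,v_0)$. *)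

theory Defs
  imports Complex_Main "HOL-Library.Poly_Mapping"
begin

section \<open>Polynomials, scalars and grading\<close>

text \<open>
  Polynomials in finitely many variables indexed by the type \<open>'v\<close>: finitely supported
  functions from monomials (exponent vectors) to coefficients.  The number \<open>r\<close> of variables is
  the cardinality of \<open>'v\<close>.  The same type serves for \<open>R = k[x]\<close> and for \<open>S = k[y]\<close>.
\<close>

type_synonym 'v mono = "'v \<Rightarrow>\<^sub>0 nat"

type_synonym ('v, 'k) mpoly = "'v mono \<Rightarrow>\<^sub>0 'k"

definition Var :: "'v \<Rightarrow> ('v, 'k::field_char_0) mpoly" where
  "Var i = Poly_Mapping.single (Poly_Mapping.single i 1) 1"

definition scalar_mult :: "'k::field_char_0 \<Rightarrow> ('v, 'k) mpoly \<Rightarrow> ('v, 'k) mpoly" where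
  "scalar_mult c p = Poly_Mapping.single 0 c * p"

global_interpretation kvs: vector_space "scalar_mult :: 'k::field_char_0 \<Rightarrow> ('v, 'k) mpoly \<Rightarrow> _"
proof
  fix a b :: 'k and x y :: "('v, 'k) mpoly"
  show "scalar_mult a (x + y) = scalar_mult a x + scalar_mult a y"
    by (simp add: scalar_mult_def distrib_left)
  show "scalar_mult (a + b) x = scalar_mult a x + scalar_mult b x"
    by (simp add: scalar_mult_def single_add distrib_right)
  show "scalar_mult a (scalar_mult b x) = scalar_mult (a * b) x"
    by (simp add: scalar_mult_def mult_single flip: mult.assoc)
  show "scalar_mult 1 x = x"
    by (simp add: scalar_mult_def)
qed

definition mdeg :: "('v::finite) mono \<Rightarrow> nat" where
  "mdeg m = (\<Sum>i\<in>UNIV. Poly_Mapping.lookup m i)"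

definition forms :: "nat \<Rightarrow> ('v::finite, 'k::field_char_0) mpoly set" where
  "forms d = {p. \<forall>m\<in>Poly_Mapping.keys p. mdeg m = d}"

definition hom_part :: "nat \<Rightarrow> ('v::finite, 'k::field_char_0) mpoly \<Rightarrow> ('v, 'k) mpoly" where
  "hom_part d p =
     (\<Sum>m\<in>{m \<in> Poly_Mapping.keys p. mdeg m = d}. Poly_Mapping.single m (Poly_Mapping.lookup p m))"


section \<open>Dimension of a quotient space\<close>

text \<open>
  \<open>B\<close> represents a basis of the quotient space \<open>V / W\<close> (for subspaces \<open>W \<subseteq> V\<close>): the cosets of the
  elements of \<open>B\<close> are pairwise distinct, linearly independent, and span \<open>V / W\<close>.
\<close>

definition quot_basis ::
    "('v, 'k::field_char_0) mpoly set \<Rightarrow> ('v, 'k) mpoly set \<Rightarrow> ('v, 'k) mpoly set \<Rightarrow> bool" where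
  "quot_basis V W B \<longleftrightarrow>
     B \<subseteq> V \<and> (\<forall>b\<in>B. b \<notin> kvs.span (W \<union> (B - {b}))) \<and> V \<subseteq> kvs.span (W \<union> B)"

definition quot_dim ::
    "('v, 'k::field_char_0) mpoly set \<Rightarrow> ('v, 'k) mpoly set \<Rightarrow> nat" where
  "quot_dim V W = card (SOME B. quot_basis V W B)"

lemma independent_Un_quot_basis:
  assumes C: "kvs.independent C" "W = kvs.span C" and B: "quot_basis V W B"
  shows "kvs.independent (C \<union> B)" "C \<inter> B = {}"
proof -
  have W: "kvs.span (W \<union> X) = kvs.span (C \<union> X)" for X
    by (simp add: C(2) kvs.span_Un kvs.span_span)
  have nB: "b \<notin> kvs.span (C \<union> (B - {b}))" if "b \<in> B" for b
    using B that unfolding quot_basis_def W by blast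
  show disj: "C \<inter> B = {}"
    using nB by (meson UnI1 disjoint_iff kvs.span_base)
  have fin: "kvs.independent (C \<union> X)" if "finite X" "X \<subseteq> B" for X
    using that
  proof (induction X rule: finite_induct)
    case empty
    then show ?case using C by simp
  next
    case (insert x X)
    have "C \<union> X \<subseteq> C \<union> (B - {x})"
      using insert by blast
    then have "x \<notin> kvs.span (C \<union> X)"
      using nB[of x] insert.prems kvs.span_mono by blast
    then show ?case
      using insert by (simp add: kvs.independent_insert)
  qed
  show "kvs.independent (C \<union> B)"
  proof
    assume "kvs.dependent (C \<union> B)"
    then obtain T where T: "finite T" "T \<subseteq> C \<union> B" "kvs.dependent T"
      unfolding kvs.dependent_explicit by (meson order_refl)
    have "kvs.dependent (C \<union> (T \<inter> B))"
    proof (rule kvs.dependent_mono[OF T(3)])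
      show "T \<subseteq> C \<union> (T \<inter> B)" using T(2) by blast
    qed
    then show False
      using fin[of "T \<inter> B"] T by simp
  qed
qed

lemma quot_dim_add_dim:
  assumes W: "kvs.subspace W" "W \<subseteq> V" and V: "kvs.subspace V" "finite X" "V \<subseteq> kvs.span X"
  shows "quot_dim V W + kvs.dim W = kvs.dim V"
proof -
  obtain C where C: "C \<subseteq> W" "kvs.independent C" "W \<subseteq> kvs.span C" "card C = kvs.dim W"
    using kvs.basis_exists by blast
  have WC: "W = kvs.span C"
    using C W(1) by (metis kvs.span_mono kvs.span_subspace)
  obtain D where D: "C \<subseteq> D" "D \<subseteq> V" "kvs.independent D" "V \<subseteq> kvs.span D"
    using kvs.maximal_independent_subset_extend[of C V] C W by blast
  have "quot_basis V W (D - C)"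
    unfolding quot_basis_def
  proof (intro conjI ballI)
    have eq: "kvs.span (W \<union> X) = kvs.span (C \<union> X)" for X
      by (simp add: WC kvs.span_Un kvs.span_span)
    show "D - C \<subseteq> V" using D by blast
    show "V \<subseteq> kvs.span (W \<union> (D - C))"
      using D by (simp add: eq Un_absorb1)
    fix b assume b: "b \<in> D - C"
    then have "C \<union> (D - C - {b}) = D - {b}" using D by blast
    then show "b \<notin> kvs.span (W \<union> (D - C - {b}))"
      using D(3) b unfolding eq kvs.dependent_def by auto
  qed
  then have B: "quot_basis V W (SOME B. quot_basis V W B)" (is "quot_basis V W ?B")
    by (rule someI)
  note ind = independent_Un_quot_basis[OF C(2) WC B]
  have sub: "C \<union> ?B \<subseteq> V"
    using C W B by (auto simp: quot_basis_def)
  have "V \<subseteq> kvs.span (C \<union> ?B)"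
    using B by (simp add: quot_basis_def WC kvs.span_Un kvs.span_span)
  then have "card (C \<union> ?B) = kvs.dim V"
    using kvs.basis_card_eq_dim ind sub by blast
  moreover have "finite (C \<union> ?B)"
    using kvs.independent_span_bound[OF V(2) ind(1)] sub V(3) by blast
  ultimately show ?thesis
    using ind(2) C(4) by (simp add: quot_dim_def card_Un_disjoint)
qed


section \<open>Graded Artinian quotients\<close>

text \<open>Ideals are the submodules of the ring, i.e. \<open>module.subspace (*)\<close>.\<close>

lemma module_mpoly: "module ((*) :: ('v, 'k::field_char_0) mpoly \<Rightarrow> _)"
  by standard (simp_all add: algebra_simps)

definition homogeneous_ideal :: "('v::finite, 'k::field_char_0) mpoly set \<Rightarrow> bool" where
  "homogeneous_ideal I \<longleftrightarrow> module.subspace (*) I \<and> (\<forall>p\<in>I. \<forall>d. hom_part d p \<in> I)"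

text \<open>Descending chain condition for \<open>R / I\<close>; its ideals correspond to the ideals containing \<open>I\<close>.\<close>

definition artinian_quotient :: "('v, 'k::field_char_0) mpoly set \<Rightarrow> bool" where
  "artinian_quotient I \<longleftrightarrow>
     (\<forall>J :: nat \<Rightarrow> ('v, 'k) mpoly set.
        (\<forall>n. module.subspace (*) (J n) \<and> I \<subseteq> J n \<and> J (Suc n) \<subseteq> J n) \<longrightarrow>
        (\<exists>n. \<forall>m\<ge>n. J m = J n))"

text \<open>\<open>h_vector I i\<close> is the dimension of the degree \<open>i\<close> component of \<open>R / I\<close>.\<close>

definition h_vector :: "('v::finite, 'k::field_char_0) mpoly set \<Rightarrow> nat \<Rightarrow> nat" where
  "h_vector I i = quot_dim (forms i) (I \<inter> forms i)"

definition max_ideal :: "('v, 'k::field_char_0) mpoly set" where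
  "max_ideal = module.span (*) (range Var)"

text \<open>The preimage in \<open>R\<close> of the socle of \<open>R / I\<close>.\<close>

definition socle_ideal :: "('v, 'k::field_char_0) mpoly set \<Rightarrow> ('v, 'k) mpoly set" where
  "socle_ideal I = {p. \<forall>q\<in>max_ideal. q * p \<in> I}"

definition socle_vector :: "('v::finite, 'k::field_char_0) mpoly set \<Rightarrow> nat \<Rightarrow> nat" where
  "socle_vector I i = quot_dim (socle_ideal I \<inter> forms i) (I \<inter> forms i)"

definition socle_degree :: "('v::finite, 'k::field_char_0) mpoly set \<Rightarrow> nat \<Rightarrow> bool" where
  "socle_degree I e \<longleftrightarrow> h_vector I e > 0 \<and> (\<forall>i>e. h_vector I i = 0)"

text \<open>
  \<open>R / I\<close> is a level algebra of socle degree \<open>e\<close> and type \<open>t\<close>.  Nonzero linear forms in \<open>I\<close> are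
  not excluded here.
\<close>

definition level_algebra :: "('v::finite, 'k::field_char_0) mpoly set \<Rightarrow> nat \<Rightarrow> nat \<Rightarrow> bool" where
  "level_algebra I e t \<longleftrightarrow>
     homogeneous_ideal I \<and> artinian_quotient I \<and> socle_degree I e \<and>
     (\<forall>i<e. socle_vector I i = 0) \<and> socle_vector I e = t"

definition gorenstein :: "('v::finite, 'k::field_char_0) mpoly set \<Rightarrow> bool" where
  "gorenstein I \<longleftrightarrow> (\<exists>e. level_algebra I e 1)"


section \<open>Inverse systems\<close>

text \<open>
  The monomial \<open>x\<^sup>m\<close> acts on \<open>y\<^sup>n\<close> by iterated partial differentiation.  The result is
  \<open>diff_coeff m n\<close> times \<open>y\<close> to the power \<open>n - m\<close>, where the coefficient is a product of falling
  factorials; because of the truncated subtraction it vanishes unless \<open>m \<le> n\<close> componentwise.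
\<close>

definition diff_coeff :: "('v::finite) mono \<Rightarrow> 'v mono \<Rightarrow> nat" where
  "diff_coeff m n =
     (\<Prod>i\<in>UNIV. \<Prod>j<Poly_Mapping.lookup m i. Poly_Mapping.lookup n i - j)"

definition diff_act ::
    "('v::finite, 'k::field_char_0) mpoly \<Rightarrow> ('v, 'k) mpoly \<Rightarrow> ('v, 'k) mpoly" where
  "diff_act p F =
     (\<Sum>m\<in>Poly_Mapping.keys p. \<Sum>n\<in>Poly_Mapping.keys F.
        Poly_Mapping.single (n - m)
          (of_nat (diff_coeff m n) * Poly_Mapping.lookup p m * Poly_Mapping.lookup F n))"

lemma diff_coeff_add: "diff_coeff m' n * diff_coeff m (n - m') = diff_coeff (m + m') n"
proof -
  have *: "(\<Prod>j<b. (k::nat) - j) * (\<Prod>j<a. k - b - j) = (\<Prod>j<a + b. k - j)" for a b k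
    by (induction a) (simp_all add: add.commute mult.assoc[symmetric])
  show ?thesis
    unfolding diff_coeff_def lookup_add lookup_minus prod.distrib[symmetric] * ..
qed

lemma diff_act_add_left: "diff_act (p + q) F = diff_act p F + diff_act q F"
  unfolding diff_act_def
  by (rule setsum_keys_plus_distrib)
    (simp_all add: ring_distribs single_add sum.distrib)

lemma diff_act_add_right: "diff_act p (F + G) = diff_act p F + diff_act p G"
  unfolding diff_act_def sum.distrib[symmetric]
  by (rule sum.cong[OF refl], rule setsum_keys_plus_distrib)
    (simp_all add: ring_distribs single_add)

lemma diff_act_single:
  "diff_act (Poly_Mapping.single m a) (Poly_Mapping.single n b) =
     Poly_Mapping.single (n - m) (of_nat (diff_coeff m n) * a * b)"
  by (simp add: diff_act_def)

lemma mpoly_induct [case_names single add]: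
  fixes p :: "('v, 'k::field_char_0) mpoly"
  assumes "\<And>m a. P (Poly_Mapping.single m a)" and "\<And>p q. P p \<Longrightarrow> P q \<Longrightarrow> P (p + q)"
  shows "P p"
proof (induction p rule: update_induct)
  case const
  show ?case using assms(1)[of 0 0] by simp
next
  case (update f a b)
  have "Poly_Mapping.update a b f = f + Poly_Mapping.single a b"
    using update by (intro poly_mapping_eqI) (auto simp: lookup_update lookup_add lookup_single in_keys_iff)
  then show ?case using assms update by simp
qed

lemma diff_act_mult: "diff_act p (diff_act q F) = diff_act (p * q) F"
proof (induction p rule: mpoly_induct)
  case (single m a)
  show ?case
  proof (induction q rule: mpoly_induct)
    case (single m' b)
    show ?case
    proof (induction F rule: mpoly_induct)
      case (single n c)
      have "n - m' - m = n - (m + m')"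
        by (simp add: add.commute diff_diff_add)
      then show ?case
        by (simp add: diff_act_single mult_single mult.assoc mult.left_commute
            flip: diff_coeff_add)
    qed (simp add: diff_act_add_right)
  qed (simp add: diff_act_add_right diff_act_add_left distrib_left)
qed (simp add: diff_act_add_left distrib_right)

global_interpretation dmod: module "diff_act :: ('v::finite, 'k::field_char_0) mpoly \<Rightarrow> _"
proof
  fix a b x y :: "('v, 'k) mpoly"
  show "diff_act 1 x = x"
  proof (induction x rule: mpoly_induct)
    case (single n c)
    show ?case
      using diff_act_single[of 0 1 n c] by (simp add: diff_coeff_def)
  qed (simp add: diff_act_add_right)
qed (simp_all add: diff_act_add_left diff_act_add_right diff_act_mult)

lemma diff_act_Var:
  "diff_act (Var i) F =
     (\<Sum>n\<in>Poly_Mapping.keys F. Poly_Mapping.single (n - Poly_Mapping.single i 1)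
        (of_nat (Poly_Mapping.lookup n i) * Poly_Mapping.lookup F n))"
proof -
  have "(\<Prod>j<(Poly_Mapping.lookup (Poly_Mapping.single i (1::nat)) k). Poly_Mapping.lookup n k - j)
     = (if k = i then Poly_Mapping.lookup n i else 1)" for n k
    by (auto simp: lookup_single)
  then have "diff_coeff (Poly_Mapping.single i 1) n = Poly_Mapping.lookup n i" for n
    unfolding diff_coeff_def by simp
  then show ?thesis
    by (simp add: diff_act_def Var_def)
qed

definition inverse_system ::
    "('v::finite, 'k::field_char_0) mpoly set \<Rightarrow> ('v, 'k) mpoly set" where
  "inverse_system I = {F. \<forall>p\<in>I. diff_act p F = 0}"

definition ann :: "('v::finite, 'k::field_char_0) mpoly set \<Rightarrow> ('v, 'k) mpoly set" where
  "ann N = {p. \<forall>F\<in>N. diff_act p F = 0}"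


section \<open>O-sequences\<close>

definition binomial_expansion :: "nat \<Rightarrow> nat \<Rightarrow> nat \<Rightarrow> (nat \<Rightarrow> nat) \<Rightarrow> bool" where
  "binomial_expansion n i j c \<longleftrightarrow>
     1 \<le> j \<and> j \<le> i \<and> j \<le> c j \<and> strict_mono_on {j..i} c \<and> n = (\<Sum>l=j..i. c l choose l)"

text \<open>\<open>macaulay_bound n i\<close> is \<open>n\<close> to the power \<open><i>\<close> in Macaulay's notation.\<close>

definition macaulay_bound :: "nat \<Rightarrow> nat \<Rightarrow> nat" where
  "macaulay_bound n i =
     (if n = 0 then 0
      else THE b. \<exists>j c. binomial_expansion n i j c \<and> b = (\<Sum>l=j..i. (c l + 1) choose (l + 1)))"

lemma binomial_sum_less:
  assumes "1 \<le> j" "j \<le> i" "j \<le> c j" "strict_mono_on {j..i} c"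
  shows "(\<Sum>l=j..i. c l choose l) < (c i + 1) choose i"
  using assms(2,4)
proof (induction i rule: dec_induct)
  case base
  obtain j' where "j = Suc j'" using assms(1) by (cases j) auto
  then show ?case using assms(3) by (simp add: zero_less_binomial)
next
  case (step i)
  have "strict_mono_on {j..i} c"
    using step.prems by (rule monotone_on_subset) auto
  then have "(\<Sum>l=j..i. c l choose l) < (c i + 1) choose i"
    by (rule step.IH)
  also have "c i < c (Suc i)"
    using step by (intro strict_mono_onD[OF step.prems]) auto
  then have "(c i + 1) choose i \<le> c (Suc i) choose i"
    by (intro binomial_right_mono) auto
  finally show ?case
    using step.hyps by simp
qed

lemma binomial_expansion_top:
  assumes "binomial_expansion n i j c"
  shows "(c i choose i) \<le> n" "n < (c i + 1) choose i"
proof -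
  have "j \<le> i" "n = (\<Sum>l=j..i. c l choose l)"
    using assms by (auto simp: binomial_expansion_def)
  then show "(c i choose i) \<le> n"
    using member_le_sum[of i "{j..i}" "\<lambda>l. c l choose l"] by simp
  show "n < (c i + 1) choose i"
    using assms binomial_sum_less by (auto simp: binomial_expansion_def)
qed

lemma binomial_expansion_unique:
  assumes "binomial_expansion n i j c" "binomial_expansion n i j' c'"
  shows "j = j' \<and> (\<forall>l\<in>{j..i}. c l = c' l)"
  using assms
proof (induction i arbitrary: n)
  case 0
  then show ?case by (simp add: binomial_expansion_def)
next
  case (Suc i)
  have top: "c (Suc i) = c' (Suc i)"
  proof (rule ccontr)
    have *: False
      if "binomial_expansion n (Suc i) j c" "binomial_expansion n (Suc i) j' c'"
        "c (Suc i) < c' (Suc i)" for c c' j j'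
    proof -
      have "(c (Suc i) + 1) choose Suc i \<le> c' (Suc i) choose Suc i"
        using that(3) by (intro binomial_right_mono) auto
      then show False
        using binomial_expansion_top(2)[OF that(1)] binomial_expansion_top(1)[OF that(2)] by linarith
    qed
    assume "c (Suc i) \<noteq> c' (Suc i)"
    then show False
      using *[OF Suc.prems] *[OF Suc.prems(2,1)] by linarith
  qed
  define n' where "n' = n - (c (Suc i) choose Suc i)"
  have low: "(j = Suc i \<and> n' = 0) \<or> (j \<le> i \<and> n' > 0 \<and> binomial_expansion n' i j c)"
    if E: "binomial_expansion n (Suc i) j c" and t: "n' = n - (c (Suc i) choose Suc i)" for j c
  proof (cases "j = Suc i")
    case True
    then show ?thesis using E t by (simp add: binomial_expansion_def)
  next
    case False
    then have ji: "j \<le> i" using E by (simp add: binomial_expansion_def)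
    then have n': "n' = (\<Sum>l=j..i. c l choose l)"
      using E t by (simp add: binomial_expansion_def)
    have "(c j choose j) \<le> n'"
      unfolding n' using ji member_le_sum[of j "{j..i}" "\<lambda>l. c l choose l"] by simp
    moreover have "(c j choose j) > 0"
      using E by (simp add: binomial_expansion_def zero_less_binomial)
    moreover have "strict_mono_on {j..i} c"
      using E by (auto simp: binomial_expansion_def intro: monotone_on_subset)
    ultimately have "n' > 0" "binomial_expansion n' i j c"
      using ji n' E unfolding binomial_expansion_def by linarith+
    then show ?thesis using ji by blast
  qed
  show ?case
    using low[OF Suc.prems(1) n'_def]
  proof (elim disjE conjE)
    assume "j = Suc i" "n' = 0"
    then show ?thesis
      using low[OF Suc.prems(2)] top n'_def by auto
  next
    assume 1: "j \<le> i" "n' > 0" "binomial_expansion n' i j c"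
    then have "binomial_expansion n' i j' c'"
      using low[OF Suc.prems(2)] top n'_def by auto
    then have "j = j' \<and> (\<forall>l\<in>{j..i}. c l = c' l)"
      using Suc.IH 1(3) by blast
    then show ?thesis
      using top by (metis atLeastAtMost_iff le_Suc_eq)
  qed
qed

lemma macaulay_bound_eq:
  assumes "binomial_expansion n i j c" "n \<noteq> 0"
  shows "macaulay_bound n i = (\<Sum>l=j..i. (c l + 1) choose (l + 1))"
proof -
  have "(THE b. \<exists>j c. binomial_expansion n i j c \<and> b = (\<Sum>l=j..i. (c l + 1) choose (l + 1)))
      = (\<Sum>l=j..i. (c l + 1) choose (l + 1))"
  proof (rule the_equality)
    fix b assume "\<exists>j c. binomial_expansion n i j c \<and> b = (\<Sum>l=j..i. (c l + 1) choose (l + 1))"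
    then obtain j' c' where 1: "binomial_expansion n i j' c'"
        "b = (\<Sum>l=j'..i. (c' l + 1) choose (l + 1))" by blast
    then show "b = (\<Sum>l=j..i. (c l + 1) choose (l + 1))"
      using binomial_expansion_unique[OF 1(1) assms(1)] by (auto intro!: sum.cong)
  qed (use assms in blast)
  then show ?thesis using assms(2) by (simp add: macaulay_bound_def)
qed

definition O_sequence :: "(nat \<Rightarrow> nat) \<Rightarrow> bool" where
  "O_sequence v \<longleftrightarrow> v 0 = 1 \<and> (\<forall>d\<ge>1. v (d + 1) \<le> macaulay_bound (v d) d)"

text \<open>
  A vector indexed by \<open>0, \<dots>, e\<close> is represented by a function on the natural numbers vanishing
  above \<open>e\<close>; this is its reverse.
\<close>

definition reverse :: "nat \<Rightarrow> (nat \<Rightarrow> nat) \<Rightarrow> nat \<Rightarrow> nat" where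
  "reverse e v = (\<lambda>i. if i \<le> e then v (e - i) else 0)"

end

(*
  Put h'' = H(R / (Ann F + Ann G)).  Since I and Ann F \<inter> Ann G have the same Hilbert function and
  dim <N>_i = H(R / Ann N)_i for graded N (perfectness of the derivative pairing in characteristic
  zero), h'' = H_F + H_G - h, where H_F, H_G belong to <F>, <G>.  Hence h' = h - H_G is the Hilbert
  function of <F, G> / <G>, a cyclic module generated in degree e by the class of F, so its reverse
  is the Hilbert function of R / {p. pF \<in> <G>}; symmetrically for h'''.  All three are h-vectors of
  quotients of A, so they are O-sequences by Macaulay's theorem.

  Macaulay's theorem is reduced to monomials by passing to standard monomials for a weight order.
  There, compressions towards one variable z give a set N of the same size, with no larger shadow P,
  such that N / z = P; Green's bound for the monomials of P free of z and induction on the degree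
  and on the number of variables finish the proof.
*)
theory Submission
  imports Defs "HOL-Library.FuncSet"
begin

section \<open>Macaulay representations\<close>

text \<open>Macaulay's and Green's bounds support each other. In a fixed degree, Macaulay's bound
  gives card P <= card (shadow P) + green (card P) by the arithmetic of \<open>le_add_green\<close>;
  one degree higher, that inequality and \<open>add_mac_green\<close> give Macaulay's bound again.
  Stability towards z gives the inequality its meaning: for a stable P, card P - card (shadow P)
  counts the monomials free of z, so sizes alone carry the induction. On the algebraic side, the
  passages from I to its inverse system and from a graded submodule to its annihilator are both
  orthogonal complements, degree by degree, for one symmetric form: the constant term of pF.
  Monomials are orthogonal for it and their norms are products of factorials, which is where
  characteristic zero enters. The generators come with arbitrary degrees; the value h e = 2, read
  off from the type, forces both degrees to be e. The three summands are introduced as Hilbert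
  functions and related by sums, because subtraction of natural numbers truncates.\<close>

declare binomial_eq_0 [simp]

text \<open>
  The top entry of the greedy expansion of \<open>p\<close> with lowest index \<open>Suc d\<close>; \<open>mac d p\<close> is \<open>p\<close> to the
  power \<open><d>\<close>, and \<open>green d p\<close> is Green's lower bracket \<open>\<Sum>l. (n\<^sub>l - 1) choose l\<close>.
\<close>

definition binom_top :: "nat \<Rightarrow> nat \<Rightarrow> nat" where
  "binom_top d p = (LEAST m. p < (m + 1) choose Suc d)"

fun mac :: "nat \<Rightarrow> nat \<Rightarrow> nat" where
  "mac 0 p = 0"
| "mac (Suc d) p =
     (binom_top d p + 1 choose Suc (Suc d)) + mac d (p - (binom_top d p choose Suc d))"

fun green :: "nat \<Rightarrow> nat \<Rightarrow> nat" where
  "green 0 p = 0"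
| "green (Suc d) p =
     (binom_top d p - 1 choose Suc d) + green d (p - (binom_top d p choose Suc d))"

lemma binom_top_eq:
  assumes "r < m choose d"
  shows "binom_top d ((m choose Suc d) + r) = m"
  unfolding binom_top_def
proof (rule Least_equality)
  show "(m choose Suc d) + r < (m + 1) choose Suc d"
    using assms by simp
  fix k assume k: "(m choose Suc d) + r < (k + 1) choose Suc d"
  show "m \<le> k"
  proof (rule ccontr)
    assume "\<not> m \<le> k"
    then have "(k + 1) choose Suc d \<le> m choose Suc d"
      by (intro binomial_right_mono) auto
    then show False using k by linarith
  qed
qed

text \<open>Greedy choice of the top entry. The value 0 is decomposed with m = d, where d choose Suc
  d is 0; so expansions are padded with vanishing binomials down to index 1 instead of stopping at a
  lowest index.\<close>

lemma binom_decomp: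
  obtains m r where "p = (m choose Suc d) + r" "r < m choose d" "d \<le> m"
proof -
  have "p < (p + d + 1) choose Suc d"
  proof (induction p)
    case 0
    then show ?case by simp
  next
    case (Suc p)
    have "(Suc p + d) choose d \<ge> 1"
      by (simp add: Suc_leI zero_less_binomial)
    then show ?case using Suc by simp
  qed
  then have ex: "\<exists>m. p < (m + 1) choose Suc d" by blast
  define m where "m = (LEAST m. p < (m + 1) choose Suc d)"
  have up: "p < (m + 1) choose Suc d"
    unfolding m_def using ex by (rule LeastI_ex)
  have lo: "m choose Suc d \<le> p"
  proof (cases m)
    case (Suc k)
    then have "\<not> p < (k + 1) choose Suc d"
      using not_less_Least[of k "\<lambda>m. p < (m + 1) choose Suc d"] by (simp add: m_def)
    then show ?thesis using Suc by simp
  qed simp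
  have "p - (m choose Suc d) < m choose d"
    using up lo by simp
  moreover from this have "d \<le> m"
    by (metis binomial_eq_0 not_le not_less_zero)
  ultimately show thesis
    using that[of m "p - (m choose Suc d)"] lo by simp
qed

lemma mac_eq: "r < m choose d \<Longrightarrow>
    mac (Suc d) ((m choose Suc d) + r) = (m + 1 choose Suc (Suc d)) + mac d r"
  by (simp add: binom_top_eq)

lemma green_eq: "r < m choose d \<Longrightarrow>
    green (Suc d) ((m choose Suc d) + r) = (m - 1 choose Suc d) + green d r"
  by (simp add: binom_top_eq)

declare mac.simps(2) [simp del] green.simps(2) [simp del]

lemma mac_zero [simp]: "mac d 0 = 0"
proof (induction d)
  case (Suc d)
  then show ?case using mac_eq[of 0 d d] by (simp add: binomial_eq_0)
qed simp

lemma green_zero [simp]: "green d 0 = 0"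
proof (induction d)
  case (Suc d)
  then show ?case using green_eq[of 0 d d] by (simp add: binomial_eq_0)
qed simp

lemma mac_binomial: "d \<le> m \<Longrightarrow> mac (Suc d) (m choose Suc d) = Suc m choose Suc (Suc d)"
  using mac_eq[of 0 m d] by (simp add: zero_less_binomial)

text \<open>Compare the top entries. When m < m', the remainder r is below m choose Suc d, so by
  induction and Pascal's rule the bracket of p stays below the leading term of the bracket of p'.
  Strictness is what the contrapositive argument in \<open>le_add_green\<close> uses.\<close>

lemma mac_strict_mono: "p < p' \<Longrightarrow> mac (Suc d) p < mac (Suc d) p'"
proof (induction d arbitrary: p p')
  case 0
  have eq: "mac (Suc 0) k = Suc k choose Suc (Suc 0)" for k
    using mac_eq[of 0 k 0] by simp
  show ?case
    by (rule lift_Suc_mono_less[OF _ 0]) (simp add: eq)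
next
  case (Suc d)
  obtain m r where m: "p = (m choose Suc (Suc d)) + r" "r < m choose Suc d" "Suc d \<le> m"
    by (rule binom_decomp)
  obtain m' r' where m': "p' = (m' choose Suc (Suc d)) + r'" "r' < m' choose Suc d" "Suc d \<le> m'"
    by (rule binom_decomp)
  note eqs = mac_eq[OF m(2)] mac_eq[OF m'(2)]
  consider "m = m'" | "m < m'" | "m' < m" by linarith
  then show ?case
  proof cases
    case 1
    then have "r < r'" using Suc.prems m m' by simp
    then show ?thesis using Suc.IH 1 m m' eqs by simp
  next
    case 2
    have "mac (Suc d) r < mac (Suc d) (m choose Suc d)"
      using Suc.IH m(2) .
    also have "\<dots> = Suc m choose Suc (Suc d)"
      using mac_binomial m(3) by simp
    finally have "mac (Suc (Suc d)) p < Suc (Suc m) choose Suc (Suc (Suc d))"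
      using eqs(1) m(1) by simp
    also have "\<dots> \<le> Suc m' choose Suc (Suc (Suc d))"
      using 2 by (intro binomial_right_mono) auto
    finally show ?thesis using eqs(2) m'(1) by simp
  next
    case 3
    have "p' < Suc m' choose Suc (Suc d)" using m' by simp
    also have "\<dots> \<le> m choose Suc (Suc d)"
      using 3 by (intro binomial_right_mono) auto
    finally show ?thesis using m(1) Suc.prems by linarith
  qed
qed

lemma mac_mono: "p \<le> p' \<Longrightarrow> mac d p \<le> mac d p'"
  by (cases d) (auto simp: le_less intro: mac_strict_mono)

section \<open>Green's lower bracket and its relations to the Macaulay bracket\<close>

lemma green_less: "r < m choose d \<Longrightarrow> Suc d \<le> m \<Longrightarrow> green d r < m - 1 choose d"
proof (induction d arbitrary: r m)
  case (Suc d)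
  obtain k r' where k: "r = (k choose Suc d) + r'" "r' < k choose d" "d \<le> k"
    by (rule binom_decomp)
  have pos: "0 < m - 1 choose Suc d"
    using Suc.prems by (simp add: zero_less_binomial)
  show ?case
  proof (cases "k = d")
    case True
    then have "r = 0" using k by simp
    then show ?thesis using pos by simp
  next
    case False
    then have kd: "Suc d \<le> k" using k by simp
    have "k < m"
    proof (rule ccontr)
      assume "\<not> k < m"
      then have "m choose Suc d \<le> k choose Suc d"
        by (intro binomial_right_mono) auto
      then show False using Suc.prems k by linarith
    qed
    have "green (Suc d) r < (k - 1 choose Suc d) + (k - 1 choose d)"
      using Suc.IH[OF k(2) kd] green_eq[OF k(2)] k(1) by simp
    also have "\<dots> = k choose Suc d"
      using kd by (cases k) auto
    also have "\<dots> \<le> m - 1 choose Suc d"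
      using \<open>k < m\<close> by (intro binomial_right_mono) auto
    finally show ?thesis .
  qed
qed simp

text \<open>Pascal's rule, term by term: \<open>green\<close> followed by \<open>mac\<close> turns n
  choose l into n choose Suc l, and adding n choose l gives Suc n choose Suc l.\<close>

lemma add_mac_green: "p + mac (Suc d) (green (Suc d) p) = mac (Suc d) p"
proof (induction d arbitrary: p)
  case 0
  have "mac (Suc 0) k = Suc k choose 2" "green (Suc 0) k = k - 1" for k
    using mac_eq[of 0 k 0] green_eq[of 0 k 0] by (simp_all add: numeral_2_eq_2)
  then show ?case by (cases p) (simp_all add: numeral_2_eq_2)
next
  case (Suc d)
  obtain m r where m: "p = (m choose Suc (Suc d)) + r" "r < m choose Suc d" "Suc d \<le> m"
    by (rule binom_decomp)
  show ?case
  \<comment> \<open>m = Suc d happens only for p = 0: the leading binomial vanishes and r <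
    1.\<close>
  proof (cases "m = Suc d")
    case True
    then show ?thesis using m by simp
  next
    case False
    then obtain k where k: "m = Suc k" "Suc d \<le> k" using m(3) by (cases m) auto
    \<comment> \<open>The lowered expansion is thus again greedy, with top entry k, and
      \<open>mac_eq\<close> applies to it.\<close>
    have "green (Suc d) r < k choose Suc d"
      using green_less[OF m(2)] k by simp
    then have "mac (Suc (Suc d)) (green (Suc (Suc d)) p)
        = (Suc k choose Suc (Suc (Suc d))) + mac (Suc d) (green (Suc d) r)"
      using m(1) green_eq[OF m(2)] mac_eq k by simp
    then show ?thesis
      using Suc.IH[of r] m(1) mac_eq[OF m(2)] k by simp
  qed
qed

text \<open>The numerical passage from Macaulay's bound to Green's, by contraposition. Let k + 1 be
  the top entry of p. If s lies below the binomial with top k, its bracket already lies below the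
  leading term of p. Otherwise that binomial splits off from s, Pascal's rule cancels the leading
  terms, and the remainders satisfy the same inequality one index lower.\<close>

lemma le_add_green:
  assumes "p \<le> mac (Suc d) s"
  shows "p \<le> s + green (Suc (Suc d)) p"
proof -
  have "s + green (Suc (Suc d)) p < p \<Longrightarrow> mac (Suc d) s < p"
  proof (induction d arbitrary: p s)
    case 0
    obtain m r where m: "p = (m choose Suc (Suc 0)) + r" "r < m choose Suc 0" "Suc 0 \<le> m"
      by (rule binom_decomp)
    then obtain k where k: "m = Suc k" by (cases m) auto
    have "green (Suc 0) r = r - 1"
      using green_eq[of 0 r 0] by simp
    then have "s + (k choose 2) + (r - 1) < (Suc k choose 2) + r"
      using 0 m green_eq[OF m(2)] k by (simp add: numeral_2_eq_2)
    then have "s < k \<or> (s \<le> k \<and> 0 < r)"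
      by (cases r) (auto simp: numeral_2_eq_2)
    moreover have "mac (Suc 0) s = Suc s choose Suc (Suc 0)"
      using mac_eq[of 0 s 0] by simp
    moreover have "mac (Suc 0) k = m choose Suc (Suc 0)"
      using mac_eq[of 0 k 0] k by simp
    moreover have "mac (Suc 0) s < mac (Suc 0) k" if "s < k"
      using that mac_strict_mono by simp
    ultimately show ?case
      using m(1) by (cases "s = k") auto
  next
    case (Suc d)
    obtain m r where m: "p = (m choose Suc (Suc (Suc d))) + r" "r < m choose Suc (Suc d)"
        "Suc (Suc d) \<le> m"
      by (rule binom_decomp)
    then obtain k where k: "m = Suc k" "Suc d \<le> k" by (cases m) auto
    have top: "mac (Suc (Suc d)) (k choose Suc (Suc d)) = m choose Suc (Suc (Suc d))"
      using mac_binomial k by simp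
    show ?case
    proof (cases "s < k choose Suc (Suc d)")
      case True
      then show ?thesis
        using mac_strict_mono[OF True, of "Suc d"] top m(1) by simp
    next
      case False
      then obtain s' where s': "s = (k choose Suc (Suc d)) + s'"
        using le_Suc_ex not_less by blast
      have "s' + green (Suc (Suc d)) r < r"
        using Suc.prems m(1) green_eq[OF m(2)] s' k by simp
      then have IH: "mac (Suc d) s' < r" by (rule Suc.IH)
      \<comment> \<open>This makes k the top entry of s, as \<open>mac_eq\<close> requires.\<close>
      have "s' < k choose Suc d"
      proof (rule ccontr)
        assume "\<not> s' < k choose Suc d"
        then have "mac (Suc d) (k choose Suc d) \<le> mac (Suc d) s'"
          by (intro mac_mono) simp
        then show False
          using IH m(2) mac_binomial[of d k] k by simp
      qed
      then show ?thesis
        using s' mac_eq IH m(1) k by simp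
    qed
  qed
  then show ?thesis using assms by (meson not_le)
qed

lemma le_add_green_1: "0 < s \<or> p = 0 \<Longrightarrow> p \<le> s + green (Suc 0) p"
  using green_eq[of 0 p 0] by auto

section \<open>Agreement of the recursion with the bracket defined by binomial expansions\<close>

lemma mac_binomial_expansion:
  "p \<noteq> 0 \<Longrightarrow> \<exists>j c. binomial_expansion p (Suc d) j c \<and>
     mac (Suc d) p = (\<Sum>l=j..Suc d. (c l + 1) choose (l + 1))"
proof (induction d arbitrary: p)
  case 0
  have "mac (Suc 0) p = Suc p choose Suc (Suc 0)"
    using mac_eq[of 0 p 0] by simp
  moreover have "binomial_expansion p (Suc 0) (Suc 0) (\<lambda>_. p)"
    using 0 by (simp add: binomial_expansion_def strict_mono_on_def)
  ultimately show ?case by force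
next
  case (Suc d)
  obtain m r where m: "p = (m choose Suc (Suc d)) + r" "r < m choose Suc d" "Suc d \<le> m"
    by (rule binom_decomp)
  have "m \<noteq> Suc d" using m Suc.prems by auto
  then have md: "Suc (Suc d) \<le> m" using m(3) by simp
  have mac: "mac (Suc (Suc d)) p = (m + 1 choose Suc (Suc (Suc d))) + mac (Suc d) r"
    using m(1) mac_eq[OF m(2)] by simp
  show ?case
  \<comment> \<open>A zero remainder ends the expansion: the padding terms of the recursion are
    dropped and the lowest index is the top one.\<close>
  proof (cases "r = 0")
    case True
    have "binomial_expansion p (Suc (Suc d)) (Suc (Suc d)) (\<lambda>_. m)"
      using md True m(1) by (simp add: binomial_expansion_def strict_mono_on_def)
    then show ?thesis
      using mac True by (intro exI[of _ "Suc (Suc d)"] exI[of _ "\<lambda>_. m"]) simp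
  next
    case False
    then obtain j c where c: "binomial_expansion r (Suc d) j c"
        "mac (Suc d) r = (\<Sum>l=j..Suc d. (c l + 1) choose (l + 1))"
      using Suc.IH by blast
    have less: "c (Suc d) < m"
    proof (rule ccontr)
      assume "\<not> c (Suc d) < m"
      then have "m choose Suc d \<le> c (Suc d) choose Suc d"
        by (intro binomial_right_mono) auto
      then show False using binomial_expansion_top(1)[OF c(1)] m(2) by linarith
    qed
    define c' where "c' = c(Suc (Suc d) := m)"
    have j: "1 \<le> j" "j \<le> Suc d" "j \<le> c j" "strict_mono_on {j..Suc d} c"
        "r = (\<Sum>l=j..Suc d. c l choose l)"
      using c(1) by (auto simp: binomial_expansion_def)
    have le: "c l \<le> c (Suc d)" if "l \<in> {j..Suc d}" for l
      using that j(2,4) by (metis atLeastAtMost_iff le_less order_refl strict_mono_onD)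
    have "strict_mono_on {j..Suc (Suc d)} c'"
    proof (rule strict_mono_onI)
      fix x y assume xy: "x \<in> {j..Suc (Suc d)}" "y \<in> {j..Suc (Suc d)}" "x < y"
      then have x: "x \<in> {j..Suc d}" by auto
      show "c' x < c' y"
      proof (cases "y = Suc (Suc d)")
        case True
        then show ?thesis using le[OF x] less x by (simp add: c'_def)
      next
        case False
        then show ?thesis
          using xy strict_mono_onD[OF j(4) x, of y] by (auto simp: c'_def)
      qed
    qed
    then have "binomial_expansion p (Suc (Suc d)) j c'"
      using j m(1) by (auto simp: binomial_expansion_def c'_def)
    moreover have "mac (Suc (Suc d)) p = (\<Sum>l=j..Suc (Suc d). (c' l + 1) choose (l + 1))"
      using mac c(2) j(2) by (simp add: c'_def)
    ultimately show ?thesis by blast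
  qed
qed

lemma macaulay_bound_eq_mac: "1 \<le> d \<Longrightarrow> macaulay_bound p d = mac d p"
proof (cases "p = 0")
  case True
  then show ?thesis by (simp add: macaulay_bound_def)
next
  case False
  assume "1 \<le> d"
  then obtain d' where "d = Suc d'" by (cases d) auto
  then show ?thesis
    using mac_binomial_expansion[OF False] macaulay_bound_eq[OF _ False] by metis
qed

section \<open>Shadows of sets of monomials\<close>

definition shadow :: "('v \<Rightarrow> nat) set \<Rightarrow> ('v \<Rightarrow> nat) set" where
  "shadow N = {m(i := m i - 1) |m i. m \<in> N \<and> 0 < m i}"

section \<open>Ranks of exponents and shadows in two variables\<close>

definition rank_in :: "nat set \<Rightarrow> nat \<Rightarrow> nat" where
  "rank_in A a = card {b \<in> A. b < a}"

lemma rank_in_le: "rank_in A a \<le> a"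
proof -
  have "rank_in A a \<le> card {..<a}"
    unfolding rank_in_def by (rule card_mono) auto
  then show ?thesis by simp
qed

lemma rank_in_strict_mono: "a \<in> A \<Longrightarrow> a < b \<Longrightarrow> rank_in A a < rank_in A b"
  unfolding rank_in_def by (rule psubset_card_mono) auto

lemma inj_on_rank_in: "inj_on (rank_in A) A"
  by (rule linorder_inj_onI') (use rank_in_strict_mono in force)

lemma rank_in_image:
  assumes "finite A"
  shows "rank_in A ` A = {..<card A}"
proof (rule card_subset_eq)
  show "rank_in A ` A \<subseteq> {..<card A}"
  proof (rule image_subsetI)
    fix a assume "a \<in> A"
    then show "rank_in A a \<in> {..<card A}"
      unfolding rank_in_def lessThan_iff using assms by (intro psubset_card_mono) auto
  qed
  show "card (rank_in A ` A) = card {..<card A}"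
    by (simp add: card_image inj_on_rank_in)
qed simp

text \<open>A gap just below a makes its rank drop strictly; this is how compression gains a power
  of z at an unstable monomial.\<close>

lemma rank_in_less_gap:
  assumes "0 < a" "a - 1 \<notin> A"
  shows "rank_in A a < a"
proof -
  have "rank_in A a \<le> card ({..<a} - {a - 1})"
    unfolding rank_in_def using assms(2) by (intro card_mono) auto
  also have "\<dots> < a" using assms(1) by (simp add: card_Diff_subset)
  finally show ?thesis .
qed

text \<open>Here \<open>A\<close> stands for the \<open>x\<close>-exponents of a set of monomials of degree \<open>s\<close> in \<open>x, z\<close>.\<close>

lemma two_variable_shadow:
  assumes "A \<subseteq> {..s}"
  shows "min (card A) s \<le> card {a. a < s \<and> (a \<in> A \<or> Suc a \<in> A)}" (is "_ \<le> card ?S")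
proof (cases "A = {..s}")
  case True
  \<comment> \<open>All s + 1 exponents are present but the shadow has only s; this case is the
    reason for the minimum.\<close>
  then have "?S = {..<s}" by auto
  then show ?thesis by simp
next
  case False
  then obtain t where t: "t \<le> s" "t \<notin> A" using assms by auto
  \<comment> \<open>Divide by z below the missing exponent t and by x above it; the gap at t keeps
    the map injective.\<close>
  define f where "f a = (if a < t then a else a - 1)" for a
  have ne: "a \<noteq> t" if "a \<in> A" for a using that t by auto
  have "inj_on f A"
  proof (rule inj_onI)
    fix a b assume "a \<in> A" "b \<in> A" "f a = f b"
    then show "a = b" using ne[of a] ne[of b] by (auto simp: f_def split: if_splits)
  qed
  moreover have "f ` A \<subseteq> ?S"
  proof (rule image_subsetI)
    fix a assume a: "a \<in> A"
    then have "a \<le> s" "a \<noteq> t" using assms ne by auto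
    then show "f a \<in> ?S" using a t by (auto simp: f_def)
  qed
  ultimately have "card A \<le> card ?S" by (intro card_inj_on_le) auto
  then show ?thesis by simp
qed

section \<open>Compression along lines of monomials in two variables\<close>

definition slide :: "'v \<Rightarrow> 'v \<Rightarrow> ('v \<Rightarrow> nat) \<Rightarrow> nat \<Rightarrow> ('v \<Rightarrow> nat)" where
  "slide x z m a = m(x := a, z := m x + m z - a)"

text \<open>The bound on a excludes truncation in \<open>slide\<close>. For distinct x and z, the
  monomials of N on the line through m are then listed once each, by their x-exponent.\<close>

definition fibre :: "'v \<Rightarrow> 'v \<Rightarrow> ('v \<Rightarrow> nat) set \<Rightarrow> ('v \<Rightarrow> nat) \<Rightarrow> nat set" where
  "fibre x z N m = {a. a \<le> m x + m z \<and> slide x z m a \<in> N}"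

text \<open>
  Compression towards \<open>z\<close> along each set of monomials that agree outside \<open>x, z\<close> and have the
  same degree: the monomial with the \<open>k\<close>-th smallest \<open>x\<close>-exponent gets \<open>x\<close>-exponent \<open>k\<close>.
\<close>

definition compress :: "'v \<Rightarrow> 'v \<Rightarrow> ('v \<Rightarrow> nat) set \<Rightarrow> ('v \<Rightarrow> nat) \<Rightarrow> ('v \<Rightarrow> nat)" where
  "compress x z N m = slide x z m (rank_in (fibre x z N m) (m x))"

lemma finite_fibre: "finite (fibre x z N m)"
  unfolding fibre_def by simp

context
  fixes x z :: 'v
  assumes xz: "x \<noteq> z"
begin

lemma slide_self: "slide x z m (m x) = m"
  using xz by (auto simp: slide_def)

lemma slide_x: "slide x z m a x = a"
  using xz by (simp add: slide_def)

lemma slide_sum: "a \<le> m x + m z \<Longrightarrow> slide x z m a x + slide x z m a z = m x + m z"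
  using xz by (simp add: slide_def)

lemma slide_slide: "a \<le> m x + m z \<Longrightarrow> slide x z (slide x z m a) b = slide x z m b"
  using xz by (auto simp: slide_def)

lemma fibre_slide: "a \<le> m x + m z \<Longrightarrow> fibre x z N (slide x z m a) = fibre x z N m"
  by (simp add: fibre_def slide_sum slide_slide)

lemma mem_fibre_self: "m x \<in> fibre x z N m \<longleftrightarrow> m \<in> N"
  by (simp add: fibre_def slide_self)

lemma rank_le_sum: "rank_in A (m x) \<le> m x + m z"
  using rank_in_le trans_le_add1 by blast

text \<open>Compression moves a monomial only along its own line, so every argument can be made one
  fibre at a time.\<close>

lemma compress_fibre: "fibre x z N (compress x z N m) = fibre x z N m"
  by (simp add: compress_def fibre_slide rank_le_sum)

lemma compress_x: "compress x z N m x = rank_in (fibre x z N m) (m x)"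
  by (simp add: compress_def slide_x)

lemma slide_compress: "slide x z (compress x z N m) (m x) = m"
  unfolding compress_def slide_slide[OF rank_le_sum] by (rule slide_self)

lemma inj_on_compress: "inj_on (compress x z N) N"
proof (rule inj_onI)
  fix m m' assume m: "m \<in> N" "m' \<in> N" and eq: "compress x z N m = compress x z N m'"
  have fib: "fibre x z N m = fibre x z N m'"
    using compress_fibre[of N m] compress_fibre[of N m'] eq by simp
  have rank: "rank_in (fibre x z N m) (m x) = rank_in (fibre x z N m) (m' x)"
    using compress_x[of N m] compress_x[of N m'] eq fib by simp
  have mem: "m x \<in> fibre x z N m" "m' x \<in> fibre x z N m"
    using m mem_fibre_self[of m N] mem_fibre_self[of m' N] fib by simp_all
  have "m x = m' x"
  proof (rule inj_onD)
    show "inj_on (rank_in (fibre x z N m)) (fibre x z N m)" by (rule inj_on_rank_in)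
    show "rank_in (fibre x z N m) (m x) = rank_in (fibre x z N m) (m' x)" by (rule rank)
    show "m x \<in> fibre x z N m" "m' x \<in> fibre x z N m" by (rule mem)+
  qed
  then have "slide x z (compress x z N m) (m x) = slide x z (compress x z N m') (m' x)"
    by (simp only: eq)
  then show "m = m'" by (simp only: slide_compress)
qed

text \<open>Ranks in a finite set fill an initial segment. Hence on each line the image consists of
  the smallest x-exponents and depends on N only through the size of the fibre.\<close>

lemma mem_compress_image:
  "w \<in> compress x z N ` N \<longleftrightarrow> w x < card (fibre x z N w)"
proof
  assume "w \<in> compress x z N ` N"
  then obtain m where m: "m \<in> N" "w = compress x z N m" by blast
  then have "rank_in (fibre x z N m) (m x) \<in> {..<card (fibre x z N m)}"
    using imageI[of "m x" "fibre x z N m"] unfolding rank_in_image[OF finite_fibre, symmetric]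
    by (simp add: mem_fibre_self)
  then show "w x < card (fibre x z N w)"
    using m compress_fibre compress_x by simp
next
  assume "w x < card (fibre x z N w)"
  then have "w x \<in> rank_in (fibre x z N w) ` fibre x z N w"
    unfolding rank_in_image[OF finite_fibre] by simp
  then obtain a where a: "a \<in> fibre x z N w" "w x = rank_in (fibre x z N w) a"
    by blast
  have le: "a \<le> w x + w z" and mem: "slide x z w a \<in> N"
    using a(1) by (auto simp: fibre_def)
  have "compress x z N (slide x z w a) = w"
    unfolding compress_def fibre_slide[OF le] slide_x slide_slide[OF le]
    by (simp add: slide_self flip: a(2))
  then show "w \<in> compress x z N ` N" using imageI[OF mem, of "compress x z N"] by simp
qed

text \<open>By \<open>mem_compress_image\<close> only fibre sizes matter. Division by a variable
  other than x and z carries a fibre of N into a fibre of its shadow with the same x-exponents.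
  Division by x or z leads to a line of degree one less, where \<open>two_variable_shadow\<close>
  bounds the fibre of the shadow from below.\<close>

lemma shadow_compress: "shadow (compress x z N ` N) \<subseteq> compress x z (shadow N) ` shadow N"
proof
  fix w' assume "w' \<in> shadow (compress x z N ` N)"
  then obtain w i where w: "w \<in> compress x z N ` N" "0 < w i" "w' = w(i := w i - 1)"
    unfolding shadow_def by blast
  have wx: "w x < card (fibre x z N w)" using w(1) mem_compress_image by blast
  have shadowI: "m(i := m i - 1) \<in> shadow N" if "m \<in> N" "0 < m i" for m i
    using that unfolding shadow_def by blast
  have "w' x < card (fibre x z (shadow N) w')"
  proof (cases "i = x \<or> i = z")
    case False
    have "fibre x z N w \<subseteq> fibre x z (shadow N) w'"
    proof
      fix a assume a: "a \<in> fibre x z N w"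
      have "slide x z w' a = (slide x z w a)(i := slide x z w a i - 1)" "0 < slide x z w a i"
        using False w(2,3) by (auto simp: slide_def)
      then show "a \<in> fibre x z (shadow N) w'"
        using a shadowI[of "slide x z w a" i] False w(3) by (auto simp: fibre_def)
    qed
    then have "card (fibre x z N w) \<le> card (fibre x z (shadow N) w')"
      by (intro card_mono finite_fibre)
    then show ?thesis using wx w(3) False by auto
  next
    case True
    \<comment> \<open>Dividing by x and dividing by z lead to the same line, that of w', whose
      degree in x and z is s - 1.\<close>
    define s where "s = w x + w z"
    have s': "Suc (w' x + w' z) = s"
      using True w(2,3) xz by (auto simp: s_def)
    have low: "slide x z w' a = (slide x z w a)(z := slide x z w a z - 1)" for a
      using s' s_def True w(3) xz by (auto simp: slide_def fun_eq_iff)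
    have high: "slide x z w' a = (slide x z w (Suc a))(x := slide x z w (Suc a) x - 1)" for a
      using s' s_def True w(3) xz by (auto simp: slide_def fun_eq_iff)
    have "{a. a < s \<and> (a \<in> fibre x z N w \<or> Suc a \<in> fibre x z N w)} \<subseteq> fibre x z (shadow N) w'"
    proof
      fix a assume "a \<in> {a. a < s \<and> (a \<in> fibre x z N w \<or> Suc a \<in> fibre x z N w)}"
      then have a: "a < s" "slide x z w a \<in> N \<or> slide x z w (Suc a) \<in> N"
        by (auto simp: fibre_def)
      have "0 < slide x z w a z" "0 < slide x z w (Suc a) x"
        using a(1) xz by (auto simp: slide_def s_def)
      then have "slide x z w' a \<in> shadow N"
        using a(2) low[of a] high[of a] shadowI[of "slide x z w a" z]
          shadowI[of "slide x z w (Suc a)" x] by auto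
      then show "a \<in> fibre x z (shadow N) w'"
        using a(1) s' by (simp add: fibre_def)
    qed
    then have "card {a. a < s \<and> (a \<in> fibre x z N w \<or> Suc a \<in> fibre x z N w)}
        \<le> card (fibre x z (shadow N) w')"
      by (intro card_mono finite_fibre)
    moreover have "fibre x z N w \<subseteq> {..s}"
      by (auto simp: fibre_def s_def)
    ultimately have "min (card (fibre x z N w)) s \<le> card (fibre x z (shadow N) w')"
      using two_variable_shadow le_trans by blast
    \<comment> \<open>These inequalities put w' x below both branches of the minimum.\<close>
    moreover have "w' x < s" "w' x \<le> w x"
      using s' True w(3) xz by auto
    ultimately show ?thesis using wx by simp
  qed
  then show "w' \<in> compress x z (shadow N) ` shadow N"
    using mem_compress_image by blast
qed

lemma compress_z: "m z \<le> compress x z N m z"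
  using rank_in_le[of "fibre x z N m" "m x"] by (simp add: compress_def slide_def)

lemma compress_z_less:
  assumes "0 < m x" "m(x := m x - 1, z := m z + 1) \<notin> N"
  shows "m z < compress x z N m z"
proof -
  have "slide x z m (m x - 1) = m(x := m x - 1, z := m z + 1)"
    using assms(1) by (auto simp: slide_def)
  then have "m x - 1 \<notin> fibre x z N m"
    using assms(2) by (simp add: fibre_def)
  then show ?thesis
    using rank_in_less_gap[OF assms(1)]
    by (simp add: compress_def slide_def less_diff_conv add.commute)
qed

lemma sum_slide:
  assumes "finite (UNIV :: 'v set)" "a \<le> m x + m z"
  shows "sum (slide x z m a) UNIV = sum m UNIV"
proof -
  have *: "sum f UNIV = f x + (f z + sum f (UNIV - {x} - {z}))" for f :: "'v \<Rightarrow> nat"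
    using assms(1) xz by (subst sum.remove[of _ x]; simp; subst sum.remove[of _ z]; simp)
  have "sum (slide x z m a) (UNIV - {x} - {z}) = sum m (UNIV - {x} - {z})"
    by (rule sum.cong) (auto simp: slide_def)
  then show ?thesis
    using *[of m] *[of "slide x z m a"] slide_sum[OF assms(2)] by simp
qed

end

section \<open>Sets of monomials stable towards one variable\<close>

definition monos_of :: "'v set \<Rightarrow> nat \<Rightarrow> ('v \<Rightarrow> nat) set" where
  "monos_of X d = {m. sum m UNIV = d \<and> (\<forall>i. i \<notin> X \<longrightarrow> m i = 0)}"

definition z_stable :: "'v \<Rightarrow> ('v \<Rightarrow> nat) set \<Rightarrow> bool" where
  "z_stable z N \<longleftrightarrow> (\<forall>m\<in>N. \<forall>x. x \<noteq> z \<longrightarrow> 0 < m x \<longrightarrow> m(x := m x - 1, z := m z + 1) \<in> N)"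

lemma le_sum_exponent: "m i \<le> sum m (UNIV :: 'v::finite set)"
  for m :: "'v::finite \<Rightarrow> nat"
  by (rule member_le_sum) auto

lemma finite_monos_of: "finite (monos_of X d :: ('v::finite \<Rightarrow> nat) set)"
proof (rule finite_subset)
  show "monos_of X d \<subseteq> (UNIV :: 'v set) \<rightarrow>\<^sub>E {..d}"
    using le_sum_exponent by (fastforce simp: monos_of_def PiE_def)
  show "finite ((UNIV :: 'v set) \<rightarrow>\<^sub>E {..d})"
    by (intro finite_PiE) auto
qed

lemma sum_decrease:
  fixes m :: "'v::finite \<Rightarrow> nat"
  assumes "0 < m i"
  shows "Suc (sum (m(i := m i - 1)) UNIV) = sum m UNIV"
proof -
  have "sum (m(i := m i - 1)) (UNIV - {i}) = sum m (UNIV - {i})"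
    by (rule sum.cong) auto
  then show ?thesis
    using assms sum.remove[of UNIV i m] sum.remove[of UNIV i "m(i := m i - 1)"] by simp
qed

lemma shadow_monos_of:
  fixes N :: "('v::finite \<Rightarrow> nat) set"
  assumes "N \<subseteq> monos_of X (Suc d)"
  shows "shadow N \<subseteq> monos_of X d"
proof
  fix p assume "p \<in> shadow N"
  then obtain m i where m: "m \<in> N" "0 < m i" "p = m(i := m i - 1)"
    unfolding shadow_def by blast
  then have "Suc (sum p UNIV) = Suc d" "\<forall>j. j \<notin> X \<longrightarrow> p j = 0"
    using assms sum_decrease[of m i] by (auto simp: monos_of_def)
  then show "p \<in> monos_of X d" by (simp add: monos_of_def)
qed

text \<open>Among the sets with the required size and shadow bound, take one whose total z-exponent
  is maximal; the total is bounded because every z-exponent is at most the degree. If an exchange of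
  x for z led out of this set, compression along x would give a competitor with larger total, since
  compression never lowers a z-exponent and raises that of the offending monomial.\<close>

lemma exists_stable:
  fixes N :: "('v::finite \<Rightarrow> nat) set"
  assumes N: "N \<subseteq> monos_of X (Suc d)" and z: "z \<in> X"
  obtains N' where "N' \<subseteq> monos_of X (Suc d)" "card N' = card N"
    "card (shadow N') \<le> card (shadow N)" "z_stable z N'"
proof -
  define Q where "Q N' \<longleftrightarrow> N' \<subseteq> monos_of X (Suc d) \<and> card N' = card N \<and>
    card (shadow N') \<le> card (shadow N)" for N'
  define pot where "pot N' = (\<Sum>m\<in>N'. m z)" for N' :: "('v \<Rightarrow> nat) set"
  have bound: "pot N' \<le> card N * Suc d" if "Q N'" for N'
  proof -
    have "m z \<le> Suc d" if "m \<in> N'" for m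
      using \<open>Q N'\<close> that le_sum_exponent[of m z] by (auto simp: Q_def monos_of_def)
    then have "pot N' \<le> card N' * Suc d"
      unfolding pot_def using sum_bounded_above[of N' "\<lambda>m. m z" "Suc d"] by simp
    then show ?thesis using \<open>Q N'\<close> by (simp add: Q_def)
  qed
  have "Q N" using N by (simp add: Q_def)
  then have "\<exists>N'. Q N' \<and> (\<forall>N''. Q N'' \<longrightarrow> pot N'' \<le> pot N')"
    by (rule ex_has_greatest_nat[where b = "Suc (card N * Suc d)"])
      (use bound in \<open>auto simp: less_Suc_eq_le\<close>)
  then obtain N' where N': "Q N'" and max: "\<And>N''. Q N'' \<Longrightarrow> pot N'' \<le> pot N'"
    by blast
  have "z_stable z N'"
    unfolding z_stable_def
  proof (intro ballI allI impI, rule ccontr)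
    fix m x assume m: "m \<in> N'" "x \<noteq> z" "0 < m x" "m(x := m x - 1, z := m z + 1) \<notin> N'"
    define c where "c = compress x z N'"
    have inj: "inj_on c N'" unfolding c_def using m(2) by (rule inj_on_compress)
    have fin: "finite N'" using N' finite_monos_of finite_subset by (auto simp: Q_def)
    have "m \<in> monos_of X (Suc d)" using m(1) N' by (auto simp: Q_def)
    \<comment> \<open>x divides m, so it lies in X; as z does too, compressed monomials still
      involve variables of X only.\<close>
    then have Xx: "x \<in> X" using m(3) by (fastforce simp: monos_of_def)
    have "c n \<in> monos_of X (Suc d)" if "n \<in> N'" for n
    proof -
      have "n \<in> monos_of X (Suc d)" using that N' by (auto simp: Q_def)
      moreover have "c n i = 0" if "i \<notin> X" "n i = 0" for i
        using that Xx z by (auto simp: c_def compress_def slide_def)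
      ultimately show ?thesis
        using sum_slide[OF m(2) finite_UNIV rank_le_sum[OF m(2), of "fibre x z N' n" n]]
        by (simp add: monos_of_def c_def compress_def)
    qed
    moreover have "card (shadow (c ` N')) \<le> card (shadow N')"
    proof -
      have "finite (shadow N')"
        using N' finite_subset[OF shadow_monos_of[of N' X d] finite_monos_of] by (simp add: Q_def)
      then have "card (shadow (c ` N')) \<le> card (compress x z (shadow N') ` shadow N')"
        unfolding c_def by (intro card_mono finite_imageI shadow_compress[OF m(2)])
      also have "\<dots> \<le> card (shadow N')" using \<open>finite (shadow N')\<close> by (rule card_image_le)
      finally show ?thesis .
    qed
    ultimately have "Q (c ` N')"
      using N' card_image[OF inj] by (auto simp: Q_def)
    then have "pot (c ` N') \<le> pot N'" by (rule max)
    moreover have "pot (c ` N') = (\<Sum>n\<in>N'. c n z)"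
      unfolding pot_def using inj by (simp add: sum.reindex)
    moreover have "pot N' < (\<Sum>n\<in>N'. c n z)"
      unfolding pot_def
    proof (rule sum_strict_mono_ex1[OF fin])
      show "\<forall>n\<in>N'. n z \<le> c n z" using compress_z[OF m(2)] by (simp add: c_def)
      show "\<exists>n\<in>N'. n z < c n z"
        using m compress_z_less[OF m(2)] unfolding c_def by blast
    qed
    ultimately show False by simp
  qed
  then show thesis using that N' by (auto simp: Q_def)
qed

text \<open>m / x = (m z / x) / z, and stability puts m z / x into N.\<close>

lemma stable_shadow_eq:
  assumes "z_stable z N"
  shows "shadow N = (\<lambda>m. m(z := m z - 1)) ` {m \<in> N. 0 < m z}"
proof
  show "shadow N \<subseteq> (\<lambda>m. m(z := m z - 1)) ` {m \<in> N. 0 < m z}"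
  proof
    fix p assume "p \<in> shadow N"
    then obtain m i where m: "m \<in> N" "0 < m i" "p = m(i := m i - 1)"
      unfolding shadow_def by blast
    show "p \<in> (\<lambda>m. m(z := m z - 1)) ` {m \<in> N. 0 < m z}"
    proof (cases "i = z")
      case True
      then show ?thesis using m by blast
    next
      case False
      then have "m(i := m i - 1, z := m z + 1) \<in> N"
        using assms m by (simp add: z_stable_def)
      moreover have "p = (m(i := m i - 1, z := m z + 1))(z := m z + 1 - 1)"
        using m False by auto
      ultimately show ?thesis by (auto intro!: image_eqI)
    qed
  qed
qed (auto simp: shadow_def)

text \<open>Division by z is injective on the monomials divisible by z, so the shadow has as many
  elements as there are such monomials in N.\<close>

lemma stable_card:
  assumes "z_stable z N" "finite N"
  shows "card N = card {m \<in> N. m z = 0} + card (shadow N)"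
proof -
  have "inj_on (\<lambda>m. m(z := m z - 1)) {m \<in> N. 0 < m z}"
  proof (rule inj_onI)
    fix m m' assume "m \<in> {m \<in> N. 0 < m z}" "m' \<in> {m \<in> N. 0 < m z}"
      and eq: "m(z := m z - 1) = m'(z := m' z - 1)"
    then have "m z = m' z" by (metis (no_types, lifting) One_nat_def Suc_pred fun_upd_same mem_Collect_eq)
    then show "m = m'" using eq by (metis fun_upd_triv fun_upd_upd)
  qed
  then have "card (shadow N) = card {m \<in> N. 0 < m z}"
    unfolding stable_shadow_eq[OF assms(1)] by (rule card_image)
  moreover have "N = {m \<in> N. m z = 0} \<union> {m \<in> N. 0 < m z}" by auto
  ultimately show ?thesis
    using assms(2) card_Un_disjoint[of "{m \<in> N. m z = 0}" "{m \<in> N. 0 < m z}"] by fastforce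
qed

lemma stable_shadow:
  assumes "z_stable z N"
  shows "z_stable z (shadow N)"
  unfolding z_stable_def
proof (intro ballI allI impI)
  fix p x assume p: "p \<in> shadow N" "x \<noteq> z" "0 < p x"
  then obtain m where m: "m \<in> N" "0 < m z" "p = m(z := m z - 1)"
    using stable_shadow_eq[OF assms] by blast
  define n where "n = m(x := m x - 1, z := m z + 1)"
  have "n \<in> N" using assms m p by (simp add: z_stable_def n_def)
  moreover have "0 < n z" "p(x := p x - 1, z := p z + 1) = n(z := n z - 1)"
    using m p(2) by (auto simp: n_def)
  ultimately show "p(x := p x - 1, z := p z + 1) \<in> shadow N"
    by (auto simp: shadow_def)
qed

text \<open>
  For a stable set \<open>N\<close> with shadow \<open>P\<close>, division by \<open>z\<close> identifies the monomials of \<open>N\<close>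
  divisible by \<open>z\<close> with \<open>P\<close>, and likewise for \<open>P\<close> and its shadow.  Induction on the degree bounds
  the part of \<open>P\<close> free of \<open>z\<close> (Green's bound), and induction on the variables then bounds the part
  of \<open>N\<close> free of \<open>z\<close>.
\<close>

lemma card_le_mac_shadow_step:
  fixes N :: "('v::finite \<Rightarrow> nat) set"
  assumes outer: "\<And>X P :: ('v \<Rightarrow> nat) set. P \<subseteq> monos_of X (Suc d) \<Longrightarrow>
      card P \<le> card (shadow P) + green (Suc d) (card P)"
    and "N \<subseteq> monos_of X (Suc (Suc d))"
  shows "card N \<le> mac (Suc d) (card (shadow N))"
proof -
  \<comment> \<open>The number of variables is varied by varying X inside the fixed type; this is
    why \<open>monos_of\<close> carries a set of variables.\<close>
  have "finite X" by simp
  then show ?thesis using assms(2)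
  proof (induction X arbitrary: N rule: finite_induct)
    case empty
    then have "m = (\<lambda>_. 0) \<and> sum m UNIV = Suc (Suc d)" if "m \<in> N" for m
      using that by (auto simp: monos_of_def)
    then have "N = {}" by fastforce
    then show ?case by simp
  next
    case (insert z X)
    obtain M where M: "M \<subseteq> monos_of (insert z X) (Suc (Suc d))" "card M = card N"
        "card (shadow M) \<le> card (shadow N)" "z_stable z M"
      using exists_stable[OF insert.prems] by blast
    define P where "P = shadow M"
    have P: "P \<subseteq> monos_of (insert z X) (Suc d)"
      using shadow_monos_of[OF M(1)] by (simp add: P_def)
    have fin: "finite M" "finite P"
      by (rule finite_subset[OF M(1) finite_monos_of], rule finite_subset[OF P finite_monos_of])
    have "card P = card {m \<in> P. m z = 0} + card (shadow P)"
      using stable_card[OF stable_shadow[OF M(4)]] fin(2) by (simp add: P_def)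
    then have P0: "card {m \<in> P. m z = 0} \<le> green (Suc d) (card P)"
      using outer[OF P] by simp
    have "{m \<in> M. m z = 0} \<subseteq> {m \<in> monos_of (insert z X) (Suc (Suc d)). m z = 0}"
      using M(1) by blast
    also have "\<dots> \<subseteq> monos_of X (Suc (Suc d))"
      by (auto simp: monos_of_def) metis
    finally have "card {m \<in> M. m z = 0} \<le> mac (Suc d) (card (shadow {m \<in> M. m z = 0}))"
      by (rule insert.IH)
    moreover have "shadow {m \<in> M. m z = 0} \<subseteq> {m \<in> P. m z = 0}"
      by (auto simp: P_def shadow_def)
    then have "card (shadow {m \<in> M. m z = 0}) \<le> card {m \<in> P. m z = 0}"
      using fin(2) by (intro card_mono) auto
    then have "card (shadow {m \<in> M. m z = 0}) \<le> green (Suc d) (card P)"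
      using P0 by (rule le_trans)
    then have "mac (Suc d) (card (shadow {m \<in> M. m z = 0})) \<le> mac (Suc d) (green (Suc d) (card P))"
      by (rule mac_mono)
    ultimately have "card M \<le> card P + mac (Suc d) (green (Suc d) (card P))"
      using stable_card[OF M(4) fin(1)] by (simp add: P_def)
    also have "\<dots> = mac (Suc d) (card P)" by (rule add_mac_green)
    also have "\<dots> \<le> mac (Suc d) (card (shadow N))"
      using M(3) by (intro mac_mono) (simp add: P_def)
    finally show ?case using M(2) by simp
  qed
qed

text \<open>Each degree supplies the Green-type inequality for the next: \<open>le_add_green\<close>
  converts the induction hypothesis into it. At the start it says only that a non-empty set of
  monomials of degree one has a non-empty shadow.\<close>

theorem card_le_mac_shadow:
  fixes N :: "('v::finite \<Rightarrow> nat) set"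
  assumes "N \<subseteq> monos_of X (Suc (Suc d))"
  shows "card N \<le> mac (Suc d) (card (shadow N))"
  using assms
proof (induction d arbitrary: X N)
  case 0
  show ?case
  proof (rule card_le_mac_shadow_step[OF _ 0])
    fix X and P :: "('v \<Rightarrow> nat) set"
    assume P: "P \<subseteq> monos_of X (Suc 0)"
    have "shadow P \<noteq> {}" if "P \<noteq> {}"
    proof -
      obtain m where m: "m \<in> P" using \<open>P \<noteq> {}\<close> by blast
      then have "m \<in> monos_of X (Suc 0)" using P by blast
      then have "sum m UNIV \<noteq> 0" by (simp add: monos_of_def)
      then obtain i where "0 < m i" using sum.neutral[of UNIV m] by force
      then show ?thesis using m by (auto simp: shadow_def)
    qed
    moreover have "finite (shadow P)"
      using shadow_monos_of[OF P] finite_monos_of finite_subset by blast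
    ultimately have "0 < card (shadow P) \<or> card P = 0"
      by (cases "P = {}") (auto simp: card_gt_0_iff)
    then show "card P \<le> card (shadow P) + green (Suc 0) (card P)"
      by (rule le_add_green_1)
  qed
next
  case (Suc d)
  show ?case
    by (rule card_le_mac_shadow_step[OF _ Suc.prems]) (intro le_add_green Suc.IH)
qed

section \<open>Hilbert functions and standard monomials\<close>

lemma quot_basis_exists:
  assumes "kvs.subspace W" "W \<subseteq> V"
  shows "\<exists>B. quot_basis V W B"
proof -
  obtain C where C: "C \<subseteq> W" "kvs.independent C" "W \<subseteq> kvs.span C"
    by (rule kvs.maximal_independent_subset)
  have WC: "W = kvs.span C"
    using kvs.span_subspace[OF C(1,3) assms(1)] by simp
  have "C \<subseteq> V" using C(1) assms(2) by blast
  then obtain D where D: "C \<subseteq> D" "D \<subseteq> V" "kvs.independent D" "V \<subseteq> kvs.span D"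
    using kvs.maximal_independent_subset_extend[OF _ C(2)] by blast
  have eq: "kvs.span (W \<union> X) = kvs.span (C \<union> X)" for X
    by (simp add: WC kvs.span_Un kvs.span_span)
  have "quot_basis V W (D - C)"
    unfolding quot_basis_def
  proof (intro conjI ballI)
    show "D - C \<subseteq> V" using D by blast
    show "V \<subseteq> kvs.span (W \<union> (D - C))"
      using D by (simp add: eq Un_absorb1)
    fix b assume b: "b \<in> D - C"
    then have "C \<union> (D - C - {b}) = D - {b}" using D by blast
    then show "b \<notin> kvs.span (W \<union> (D - C - {b}))"
      using D(3) b unfolding eq kvs.dependent_def by auto
  qed
  then show ?thesis by blast
qed

text \<open>Together with a basis of W, any quotient basis becomes a basis of V; so the choice made
  by \<open>SOME\<close> does not affect the dimension.\<close>

lemma quot_dim_eq_card: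
  assumes B: "quot_basis V W B" and W: "kvs.subspace W" "W \<subseteq> V"
    and V: "kvs.subspace V" "finite X" "V \<subseteq> kvs.span X"
  shows "quot_dim V W = card B"
proof -
  obtain C where C: "C \<subseteq> W" "kvs.independent C" "W \<subseteq> kvs.span C" "card C = kvs.dim W"
    by (rule kvs.basis_exists)
  have WC: "W = kvs.span C"
    using kvs.span_subspace[OF C(1,3) W(1)] by simp
  note ind = independent_Un_quot_basis[OF C(2) WC B]
  have sub: "C \<union> B \<subseteq> V"
    using C W B by (auto simp: quot_basis_def)
  have "V \<subseteq> kvs.span (C \<union> B)"
    using B by (simp add: quot_basis_def WC kvs.span_Un kvs.span_span)
  then have "card (C \<union> B) = kvs.dim V"
    using kvs.basis_card_eq_dim ind sub by blast
  moreover have "C \<union> B \<subseteq> kvs.span X" using sub V(3) by blast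
  then have "finite (C \<union> B)"
    using kvs.independent_span_bound[OF V(2) ind(1)] by blast
  ultimately show ?thesis
    using ind(2) C(4) quot_dim_add_dim[OF W V] by (simp add: card_Un_disjoint)
qed

text \<open>T induces an injection from V modulo the preimage of W into U / W, and the last
  assumption makes it onto. It is applied to the identity, for sums of ideals, and to p -> pF, for
  colon ideals.\<close>

lemma quot_dim_preimage:
  assumes T: "Vector_Spaces.linear scalar_mult scalar_mult T"
    and V: "kvs.subspace V" "finite X" "V \<subseteq> kvs.span X"
    and U: "kvs.subspace U" "finite Y" "U \<subseteq> kvs.span Y"
    and W: "kvs.subspace W" "W \<subseteq> U"
    and img: "T ` V \<subseteq> U" "U \<subseteq> kvs.span (T ` V \<union> W)"
  shows "quot_dim V {v \<in> V. T v \<in> W} = quot_dim U W"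
proof -
  interpret T: Vector_Spaces.linear scalar_mult scalar_mult T by (rule T)
  define K where "K = {v \<in> V. T v \<in> W}"
  have K: "kvs.subspace K" "K \<subseteq> V"
    using kvs.subspace_inter[OF V(1) T.subspace_linear_preimage[OF W(1)]]
    by (auto simp: K_def Int_def)
  obtain B where B: "quot_basis V K B"
    using quot_basis_exists[OF K] by blast
  have BV: "B \<subseteq> V" "V \<subseteq> kvs.span (K \<union> B)"
    using B by (auto simp: quot_basis_def)
  have spW: "kvs.span W = W" using W(1) by simp
  have notin: "T b \<notin> kvs.span (W \<union> T ` (B - {b}))" if b: "b \<in> B" for b
  proof
    assume "T b \<in> kvs.span (W \<union> T ` (B - {b}))"
    then obtain w y where wy: "T b = w + T y" "w \<in> W" "y \<in> kvs.span (B - {b})"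
      unfolding kvs.span_Un spW T.span_image by blast
    have "y \<in> V"
      using wy(3) kvs.span_minimal[OF _ V(1), of "B - {b}"] BV(1) by blast
    then have "b - y \<in> V"
      using b BV(1) by (intro kvs.subspace_diff[OF V(1)]) auto
    moreover have "T (b - y) = w"
      using wy(1) T.diff by simp
    ultimately have "b - y \<in> kvs.span (K \<union> (B - {b}))"
      using wy(2) by (intro kvs.span_base) (simp add: K_def)
    moreover have "y \<in> kvs.span (K \<union> (B - {b}))"
      using wy(3) kvs.span_mono[of "B - {b}" "K \<union> (B - {b})"] by blast
    ultimately have "(b - y) + y \<in> kvs.span (K \<union> (B - {b}))"
      by (rule kvs.span_add)
    then show False
      using B b by (simp add: quot_basis_def)
  qed
  have inj: "inj_on T B"
  proof (rule inj_onI, rule ccontr)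
    fix b b' assume "b \<in> B" "b' \<in> B" "T b = T b'" "b \<noteq> b'"
    then have "T b \<in> W \<union> T ` (B - {b})" by auto
    then show False using notin[OF \<open>b \<in> B\<close>] kvs.span_base[OF \<open>T b \<in> _\<close>] by blast
  qed
  have "quot_basis U W (T ` B)"
    unfolding quot_basis_def
  proof (intro conjI ballI)
    show "T ` B \<subseteq> U" using img(1) BV(1) by blast
    fix c assume "c \<in> T ` B"
    then obtain b where b: "b \<in> B" "c = T b" by blast
    have "kvs.span (W \<union> (T ` B - {c})) \<subseteq> kvs.span (W \<union> T ` (B - {b}))"
      by (rule kvs.span_mono) (use b in auto)
    then show "c \<notin> kvs.span (W \<union> (T ` B - {c}))"
      using notin[OF b(1)] b(2) by blast
  next
    have "T ` V \<subseteq> kvs.span (T ` (K \<union> B))"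
      unfolding T.span_image using BV(2) by blast
    also have "\<dots> \<subseteq> kvs.span (W \<union> T ` B)"
      by (rule kvs.span_mono) (auto simp: K_def)
    finally have "T ` V \<union> W \<subseteq> kvs.span (W \<union> T ` B)"
      using kvs.span_superset[of "W \<union> T ` B"] by blast
    then have "kvs.span (T ` V \<union> W) \<subseteq> kvs.span (W \<union> T ` B)"
      by (rule kvs.span_minimal) simp
    then show "U \<subseteq> kvs.span (W \<union> T ` B)" using img(2) by blast
  qed
  then have "quot_dim U W = card (T ` B)"
    by (rule quot_dim_eq_card) fact+
  moreover have "quot_dim V K = card B"
    using B K V by (rule quot_dim_eq_card)
  ultimately show ?thesis
    using card_image[OF inj] by (simp add: K_def)
qed

section \<open>Monomial expansions and spaces of forms\<close>

global_interpretation rmod: module "(*) :: ('v, 'k::field_char_0) mpoly \<Rightarrow> _"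
  by (rule module_mpoly)

lemma lookup_scalar_mult [simp]: "Poly_Mapping.lookup (scalar_mult c p) m = c * Poly_Mapping.lookup p m"
  unfolding scalar_mult_def mult_map_scale_conv_mult[symmetric]
  by (simp add: Poly_Mapping.map.rep_eq when_def)

lemma scalar_mult_single: "scalar_mult c (Poly_Mapping.single m a) = Poly_Mapping.single m (c * a)"
  by (simp add: scalar_mult_def mult_single)

lemma ideal_kvs_subspace: "rmod.subspace J \<Longrightarrow> kvs.subspace J"
  by (auto simp: kvs.subspace_def rmod.subspace_def scalar_mult_def)

abbreviation monomial :: "'v mono \<Rightarrow> ('v, 'k::field_char_0) mpoly" where
  "monomial m \<equiv> Poly_Mapping.single m 1"

lemma monomial_eq_iff: "monomial m = (monomial n :: ('v, 'k::field_char_0) mpoly) \<longleftrightarrow> m = n"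
  by (metis keys_single one_neq_zero singleton_inject)

lemma monomial_expansion:
  "p = (\<Sum>m\<in>Poly_Mapping.keys p. scalar_mult (Poly_Mapping.lookup p m) (monomial m))"
proof (rule poly_mapping_eqI)
  fix k
  have "Poly_Mapping.lookup (\<Sum>m\<in>Poly_Mapping.keys p. scalar_mult (Poly_Mapping.lookup p m) (monomial m)) k
      = (\<Sum>m\<in>Poly_Mapping.keys p. if m = k then Poly_Mapping.lookup p m else 0)"
    unfolding lookup_sum by (rule sum.cong) (auto simp: lookup_single when_def)
  also have "\<dots> = Poly_Mapping.lookup p k" by (auto simp: in_keys_iff)
  finally show "Poly_Mapping.lookup p k
      = Poly_Mapping.lookup (\<Sum>m\<in>Poly_Mapping.keys p. scalar_mult (Poly_Mapping.lookup p m) (monomial m)) k" by simp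
qed

lemma forms_iff: "p \<in> forms d \<longleftrightarrow> (\<forall>m. Poly_Mapping.lookup p m \<noteq> 0 \<longrightarrow> mdeg m = d)"
  by (auto simp: forms_def in_keys_iff)

lemma subspace_forms: "kvs.subspace (forms d :: ('v::finite, 'k::field_char_0) mpoly set)"
proof (rule kvs.subspaceI)
  fix p q :: "('v, 'k) mpoly" assume "p \<in> forms d" "q \<in> forms d"
  then show "p + q \<in> forms d"
    using keys_add[of p q] by (auto simp: forms_def)
qed (auto simp: forms_iff)

lemma mdeg_lookup: "mdeg m = sum (Poly_Mapping.lookup m) UNIV"
  by (simp add: mdeg_def)

lemma inj_lookup: "inj Poly_Mapping.lookup"
  by (rule injI) (rule poly_mapping_eqI, simp)

lemma lookup_image_monos: "Poly_Mapping.lookup ` {m :: ('v::finite) mono. mdeg m = d} \<subseteq> monos_of UNIV d"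
  by (auto simp: monos_of_def mdeg_lookup)

lemma finite_monomials: "finite {m :: ('v::finite) mono. mdeg m = d}"
  by (rule finite_imageD[OF finite_subset[OF lookup_image_monos finite_monos_of]])
    (rule inj_on_subset[OF inj_lookup subset_UNIV])

lemma forms_subset_span:
  "forms d \<subseteq> kvs.span (monomial ` {m. mdeg m = d} :: ('v::finite, 'k::field_char_0) mpoly set)"
proof
  fix p :: "('v, 'k) mpoly" assume p: "p \<in> forms d"
  have "(\<Sum>m\<in>Poly_Mapping.keys p. scalar_mult (Poly_Mapping.lookup p m) (monomial m))
      \<in> kvs.span (monomial ` {m. mdeg m = d})"
    by (intro kvs.span_sum kvs.span_scale kvs.span_base) (use p in \<open>auto simp: forms_def\<close>)
  then show "p \<in> kvs.span (monomial ` {m. mdeg m = d})"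
    by (simp flip: monomial_expansion)
qed

lemma quot_dim_forms_add:
  assumes "kvs.subspace W" "W \<subseteq> V" "kvs.subspace V" "V \<subseteq> forms d"
  shows "quot_dim V W + kvs.dim W = kvs.dim V"
  using quot_dim_add_dim[OF assms(1-3) finite_imageI[OF finite_monomials]]
    forms_subset_span assms(4) by blast

section \<open>Weights and initial monomials\<close>

lemma exists_weight:
  "\<exists>w :: 'v::finite \<Rightarrow> nat. inj_on (\<lambda>m. \<Sum>i\<in>UNIV. m i * w i) {m. \<forall>i. m i \<le> D}"
proof -
  have "\<exists>w. inj_on (\<lambda>m. \<Sum>i\<in>X. m i * w i) {m. (\<forall>i. m i \<le> D) \<and> (\<forall>i. i \<notin> X \<longrightarrow> m i = 0)}"
    for X :: "'v set"
    using finite[of X]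
  proof (induction X rule: finite_induct)
    case empty
    then show ?case by (auto simp: inj_on_def)
  next
    case (insert x X)
    then obtain w where w: "inj_on (\<lambda>m. \<Sum>i\<in>X. m i * w i)
        {m. (\<forall>i. m i \<le> D) \<and> (\<forall>i. i \<notin> X \<longrightarrow> m i = 0)}" by blast
    \<comment> \<open>Positional notation: B exceeds every weight attainable with the earlier
      variables, so division by B recovers the exponent of x.\<close>
    define B where "B = Suc (\<Sum>i\<in>X. D * w i)"
    define w' where "w' = w(x := B)"
    have eq: "(\<Sum>i\<in>insert x X. m i * w' i) = (\<Sum>i\<in>X. m i * w i) + B * m x" for m
    proof -
      have "(\<Sum>i\<in>X. m i * w' i) = (\<Sum>i\<in>X. m i * w i)"
        using insert.hyps by (intro sum.cong) (auto simp: w'_def)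
      then show ?thesis using insert.hyps by (simp add: w'_def mult.commute)
    qed
    have less: "(\<Sum>i\<in>X. m i * w i) < B" if "\<forall>i. m i \<le> D" for m
      unfolding B_def using that by (intro le_imp_less_Suc sum_mono mult_right_mono) auto
    have "inj_on (\<lambda>m. \<Sum>i\<in>insert x X. m i * w' i)
        {m. (\<forall>i. m i \<le> D) \<and> (\<forall>i. i \<notin> insert x X \<longrightarrow> m i = 0)}"
    proof (rule inj_onI, unfold mem_Collect_eq)
      fix m n :: "'v \<Rightarrow> nat"
      assume m: "(\<forall>i. m i \<le> D) \<and> (\<forall>i. i \<notin> insert x X \<longrightarrow> m i = 0)"
        and n: "(\<forall>i. n i \<le> D) \<and> (\<forall>i. i \<notin> insert x X \<longrightarrow> n i = 0)"
        and "(\<Sum>i\<in>insert x X. m i * w' i) = (\<Sum>i\<in>insert x X. n i * w' i)"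
      then have s: "(\<Sum>i\<in>X. m i * w i) + B * m x = (\<Sum>i\<in>X. n i * w i) + B * n x"
        by (simp only: eq)
      have lm: "(\<Sum>i\<in>X. m i * w i) < B" and ln: "(\<Sum>i\<in>X. n i * w i) < B"
        using less m n by blast+
      have x: "m x = n x"
        using arg_cong[OF s, of "\<lambda>k. k div B"] lm ln by simp
      then have "(\<Sum>i\<in>X. m i * w i) = (\<Sum>i\<in>X. n i * w i)" using s by simp
      moreover have "(\<Sum>i\<in>X. (k(x := 0)) i * w i) = (\<Sum>i\<in>X. k i * w i)" for k
        using insert.hyps by (intro sum.cong) auto
      ultimately have "(\<Sum>i\<in>X. (m(x := 0)) i * w i) = (\<Sum>i\<in>X. (n(x := 0)) i * w i)"
        by simp
      then have "m(x := 0) = n(x := 0)"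
        by (rule inj_onD[OF w]) (use m n in auto)
      then show "m = n" using x by (metis fun_upd_triv fun_upd_upd)
    qed
    then show ?case by blast
  qed
  from this[of UNIV] show ?thesis by simp
qed

text \<open>A relation and not a function, because a weight may take equal values on several
  monomials of p.\<close>

definition leading :: "('v mono \<Rightarrow> nat) \<Rightarrow> ('v, 'k::field_char_0) mpoly \<Rightarrow> 'v mono \<Rightarrow> bool" where
  "leading \<omega> p m \<longleftrightarrow> m \<in> Poly_Mapping.keys p \<and> (\<forall>m'\<in>Poly_Mapping.keys p. \<omega> m' \<le> \<omega> m)"

definition standard_monos ::
    "('v mono \<Rightarrow> nat) \<Rightarrow> ('v::finite, 'k::field_char_0) mpoly set \<Rightarrow> nat \<Rightarrow> 'v mono set" where
  "standard_monos \<omega> J d = {m. mdeg m = d \<and> \<not> (\<exists>p\<in>J \<inter> forms d. leading \<omega> p m)}"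

lemma leading_exists: "p \<noteq> 0 \<Longrightarrow> \<exists>m. leading \<omega> p m"
proof -
  assume "p \<noteq> 0"
  then have ne: "\<omega> ` Poly_Mapping.keys p \<noteq> {}"
    by simp
  have "Max (\<omega> ` Poly_Mapping.keys p) \<in> \<omega> ` Poly_Mapping.keys p"
    by (rule Max_in) (use ne in auto)
  then obtain m where "m \<in> Poly_Mapping.keys p" "\<omega> m = Max (\<omega> ` Poly_Mapping.keys p)" by force
  then have "leading \<omega> p m" by (simp add: leading_def)
  then show ?thesis by blast
qed

lemma keys_span_monomials: "y \<in> kvs.span (monomial ` A) \<Longrightarrow> Poly_Mapping.keys y \<subseteq> A"
proof (induction rule: kvs.span_induct_alt)
  case (step c x y)
  then show ?case
    using keys_add[of "scalar_mult c x" y] by (auto simp: in_keys_iff lookup_single split: if_splits)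
qed simp

text \<open>Macaulay's basis theorem. Independence: a linear relation would give a nonzero form in J
  all of whose monomials, hence also a leading one, are standard. Spanning: modulo J, a non-standard
  monomial is a combination of monomials of strictly smaller weight, strict by injectivity.\<close>

lemma standard_monos_quot_basis:
  fixes J :: "('v::finite, 'k::field_char_0) mpoly set"
  assumes J: "kvs.subspace J" and inj: "inj_on \<omega> {m. mdeg m = d}"
  shows "quot_basis (forms d) (J \<inter> forms d) (monomial ` standard_monos \<omega> J d)"
    (is "quot_basis _ ?W (monomial ` ?N)")
  unfolding quot_basis_def
proof (intro conjI ballI)
  show "monomial ` ?N \<subseteq> forms d"
    by (auto simp: forms_def standard_monos_def)
  have W: "kvs.subspace ?W" by (rule kvs.subspace_inter[OF J subspace_forms])
  then have spW: "kvs.span ?W = ?W" by simp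
  fix b :: "('v, 'k) mpoly" assume "b \<in> monomial ` ?N"
  then obtain m where m: "m \<in> ?N" "b = monomial m" by blast
  show "b \<notin> kvs.span (?W \<union> (monomial ` ?N - {b}))"
  proof
    assume "b \<in> kvs.span (?W \<union> (monomial ` ?N - {b}))"
    then obtain w y where wy: "b = w + y" "w \<in> ?W" "y \<in> kvs.span (monomial ` ?N - {b})"
      unfolding kvs.span_Un spW by blast
    have "monomial ` ?N - {b} \<subseteq> monomial ` (?N - {m})" using m(2) by blast
    then have ky: "Poly_Mapping.keys y \<subseteq> ?N - {m}"
      using wy(3) kvs.span_mono by (intro keys_span_monomials) blast
    have w: "w = b - y" using wy(1) by simp
    have "Poly_Mapping.lookup y m = 0" using ky by (auto simp: in_keys_iff)
    then have "Poly_Mapping.lookup w m = 1" using w m(2) by (simp add: lookup_minus)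
    then have "w \<noteq> 0" by auto
    then obtain m0 where m0: "leading \<omega> w m0" using leading_exists[of w \<omega>] by blast
    then have "m0 \<in> Poly_Mapping.keys w" by (simp add: leading_def)
    then have "m0 \<in> ?N"
      using ky m by (auto simp: w in_keys_iff lookup_minus lookup_single when_def split: if_splits)
    then show False using m0 wy(2) by (auto simp: standard_monos_def)
  qed
next
  have W: "kvs.subspace ?W" by (rule kvs.subspace_inter[OF J subspace_forms])
  have mem: "monomial m \<in> kvs.span (?W \<union> monomial ` ?N)" if "mdeg m = d" for m
    using that
  proof (induction "\<omega> m" arbitrary: m rule: less_induct)
    case less
    show ?case
    proof (cases "m \<in> ?N")
      case True
      then show ?thesis by (intro kvs.span_base) blast
    next
      case False
      then obtain p where p: "p \<in> ?W" "leading \<omega> p m"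
        using less.prems by (auto simp: standard_monos_def)
      have km: "m \<in> Poly_Mapping.keys p" using p(2) by (simp add: leading_def)
      define rest where
        "rest = (\<Sum>m'\<in>Poly_Mapping.keys p - {m}. scalar_mult (Poly_Mapping.lookup p m') (monomial m' :: ('v, 'k) mpoly))"
      have "rest \<in> kvs.span (?W \<union> monomial ` ?N)"
        unfolding rest_def
      proof (intro kvs.span_sum kvs.span_scale less.hyps)
        fix m' assume m': "m' \<in> Poly_Mapping.keys p - {m}"
        then show d: "mdeg m' = d" using p(1) by (auto simp: forms_def)
        have "\<omega> m' \<noteq> \<omega> m"
          using inj_onD[OF inj, of m' m] d less.prems m' by auto
        then show "\<omega> m' < \<omega> m"
          using m' p(2) by (auto simp: leading_def le_less)
      qed
      moreover have "p \<in> kvs.span (?W \<union> monomial ` ?N)"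
        using p(1) by (intro kvs.span_base) blast
      moreover have "p = scalar_mult (Poly_Mapping.lookup p m) (monomial m) + rest"
        using monomial_expansion[of p] km by (simp add: rest_def sum.remove)
      ultimately have "scalar_mult (Poly_Mapping.lookup p m) (monomial m) \<in> kvs.span (?W \<union> monomial ` ?N)"
        using kvs.span_diff[of p _ rest] by (metis add_diff_cancel_right')
      then have "scalar_mult (inverse (Poly_Mapping.lookup p m)) (scalar_mult (Poly_Mapping.lookup p m) (monomial m))
          \<in> kvs.span (?W \<union> monomial ` ?N)"
        by (rule kvs.span_scale)
      then show ?thesis using km by (simp add: in_keys_iff)
    qed
  qed
  then have "monomial ` {m. mdeg m = d} \<subseteq> kvs.span (?W \<union> monomial ` ?N)" by blast
  then have "kvs.span (monomial ` {m. mdeg m = d}) \<subseteq> kvs.span (?W \<union> monomial ` ?N)"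
    by (rule kvs.span_minimal) simp
  then show "forms d \<subseteq> kvs.span (?W \<union> monomial ` ?N)"
    using forms_subset_span by blast
qed

lemma h_vector_standard_monos:
  fixes J :: "('v::finite, 'k::field_char_0) mpoly set"
  assumes "kvs.subspace J" "inj_on \<omega> {m. mdeg m = d}"
  shows "h_vector J d = card (standard_monos \<omega> J d)"
proof -
  have "h_vector J d = card ((monomial :: _ \<Rightarrow> ('v, 'k) mpoly) ` standard_monos \<omega> J d)"
    unfolding h_vector_def
    by (rule quot_dim_eq_card[OF standard_monos_quot_basis[OF assms]
          kvs.subspace_inter[OF assms(1) subspace_forms] _ subspace_forms
          finite_imageI[OF finite_monomials] forms_subset_span]) simp
  also have "\<dots> = card (standard_monos \<omega> J d)"
    by (rule card_image) (simp add: inj_on_def monomial_eq_iff)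
  finally show ?thesis .
qed

lemma lookup_single_mult:
  fixes p :: "('v, 'k::field_char_0) mpoly"
  shows "Poly_Mapping.lookup (Poly_Mapping.single k c * p) (k + m) = c * Poly_Mapping.lookup p m"
proof (induction p rule: mpoly_induct)
  case (single n a)
  then show ?case by (auto simp: mult_single lookup_single when_def)
qed (simp add: distrib_left lookup_add)

lemma keys_monomial_mult:
  fixes p :: "('v, 'k::field_char_0) mpoly"
  shows "Poly_Mapping.keys (monomial k * p) = (+) k ` Poly_Mapping.keys p"
proof
  show "Poly_Mapping.keys (monomial k * p) \<subseteq> (+) k ` Poly_Mapping.keys p"
    using keys_mult[of "monomial k" p] by auto
  show "(+) k ` Poly_Mapping.keys p \<subseteq> Poly_Mapping.keys (monomial k * p)"
    by (auto simp: in_keys_iff lookup_single_mult)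
qed

lemma mdeg_add: "mdeg (m + n) = mdeg m + mdeg n"
  by (simp add: mdeg_def lookup_add sum.distrib)

lemma mdeg_single [simp]: "mdeg (Poly_Mapping.single i k) = k"
  by (simp add: mdeg_def lookup_single when_def)

text \<open>Leading monomials of elements of J stay leading after multiplication by a variable,
  because the weight is additive; hence standard monomials are closed under division.\<close>

lemma shadow_standard_monos:
  fixes J :: "('v::finite, 'k::field_char_0) mpoly set"
  assumes J: "rmod.subspace J" and \<omega>: "\<And>m n. \<omega> (m + n) = \<omega> m + \<omega> n"
  shows "shadow (Poly_Mapping.lookup ` standard_monos \<omega> J (Suc d)) \<subseteq> Poly_Mapping.lookup ` standard_monos \<omega> J d"
proof
  fix f assume "f \<in> shadow (Poly_Mapping.lookup ` standard_monos \<omega> J (Suc d))"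
  then obtain m i where m: "m \<in> standard_monos \<omega> J (Suc d)" "0 < Poly_Mapping.lookup m i"
    "f = (Poly_Mapping.lookup m)(i := Poly_Mapping.lookup m i - 1)"
    unfolding shadow_def by blast
  define n where "n = m - Poly_Mapping.single i 1"
  have f: "f = Poly_Mapping.lookup n"
    by (auto simp: n_def m(3) lookup_minus lookup_single when_def)
  have mn: "m = Poly_Mapping.single i 1 + n"
    using m(2) by (intro poly_mapping_eqI) (auto simp: n_def lookup_add lookup_minus lookup_single when_def)
  have "mdeg n = d"
    using m(1) by (simp add: standard_monos_def mn mdeg_add)
  moreover have "\<not> leading \<omega> p n" if p: "p \<in> J \<inter> forms d" for p
  proof
    assume l: "leading \<omega> p n"
    let ?q = "monomial (Poly_Mapping.single i 1) * p"
    have "?q \<in> J" using p rmod.subspace_scale[OF J] by blast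
    moreover have "?q \<in> forms (Suc d)"
      using p by (auto simp: forms_def keys_monomial_mult mdeg_add)
    moreover have "leading \<omega> ?q m"
      using l by (auto simp: leading_def keys_monomial_mult mn \<omega>)
    ultimately show False using m(1) by (auto simp: standard_monos_def)
  qed
  ultimately show "f \<in> Poly_Mapping.lookup ` standard_monos \<omega> J d"
    unfolding f by (auto simp: standard_monos_def)
qed

text \<open>The substitute for a monomial order up to degree D: additivity gives compatibility with
  multiplication, injectivity gives unique leading monomials of forms, and natural values give
  well-founded induction.\<close>

lemma exists_monomial_weight:
  obtains \<omega> :: "('v::finite) mono \<Rightarrow> nat" where "\<And>m n. \<omega> (m + n) = \<omega> m + \<omega> n"
    "\<And>d. d \<le> D \<Longrightarrow> inj_on \<omega> {m. mdeg m = d}"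
proof -
  obtain w :: "'v \<Rightarrow> nat" where w: "inj_on (\<lambda>m. \<Sum>i\<in>UNIV. m i * w i) {m. \<forall>i. m i \<le> D}"
    using exists_weight by blast
  define \<omega> where "\<omega> m = (\<Sum>i\<in>UNIV. Poly_Mapping.lookup m i * w i)" for m :: "'v mono"
  show thesis
  proof
    show "\<omega> (m + n) = \<omega> m + \<omega> n" for m n
      by (simp add: \<omega>_def lookup_add distrib_right sum.distrib)
    fix d assume d: "d \<le> D"
    show "inj_on \<omega> {m. mdeg m = d}"
    proof (rule inj_onI)
      fix m n assume mn: "m \<in> {m. mdeg m = d}" "n \<in> {m. mdeg m = d}" "\<omega> m = \<omega> n"
      have "Poly_Mapping.lookup k i \<le> D" if "mdeg k = d" for k :: "'v mono" and i
        using le_sum_exponent[of "Poly_Mapping.lookup k" i] that d by (simp add: mdeg_lookup)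
      then have "Poly_Mapping.lookup m = Poly_Mapping.lookup n"
        using inj_onD[OF w, of "Poly_Mapping.lookup m" "Poly_Mapping.lookup n"] mn by (simp add: \<omega>_def)
      then show "m = n" by (rule injD[OF inj_lookup])
    qed
  qed
qed

lemma mdeg_eq_0 [simp]: "mdeg m = 0 \<longleftrightarrow> m = 0"
  by (auto simp: mdeg_def intro: poly_mapping_eqI)

theorem macaulay_O_sequence:
  fixes J :: "('v::finite, 'k::field_char_0) mpoly set"
  assumes J: "rmod.subspace J" and one: "1 \<notin> J"
  shows "O_sequence (h_vector J)"
  unfolding O_sequence_def
proof (intro conjI allI impI)
  note sub = ideal_kvs_subspace[OF J]
  \<comment> \<open>The only monomial of degree 0 is 1, so the constant weight 0 is injective
    there.\<close>
  have "standard_monos (\<lambda>_. 0) J 0 = {0}"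
  proof -
    have "\<not> leading (\<lambda>_. 0) p 0" if p: "p \<in> J \<inter> forms 0" for p
    proof
      assume "leading (\<lambda>_. 0) p 0"
      then have c: "Poly_Mapping.lookup p 0 \<noteq> 0" by (simp add: leading_def in_keys_iff)
      have "p = Poly_Mapping.single 0 (Poly_Mapping.lookup p 0)"
        using p by (intro poly_mapping_eqI) (auto simp: forms_iff lookup_single when_def)
      then have "Poly_Mapping.single 0 (inverse (Poly_Mapping.lookup p 0)) * p = 1"
        using c by (metis add_0 left_inverse mult_single single_one)
      then show False using p one rmod.subspace_scale[OF J] by (metis IntD1)
    qed
    then show ?thesis by (auto simp: standard_monos_def)
  qed
  moreover have "inj_on (\<lambda>_. 0 :: nat) {m :: 'v mono. mdeg m = 0}" by (simp add: inj_on_def)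
  ultimately show "h_vector J 0 = 1"
    using h_vector_standard_monos[OF sub] by fastforce
next
  note sub = ideal_kvs_subspace[OF J]
  fix d :: nat assume "1 \<le> d"
  then obtain d' where d: "d = Suc d'" by (cases d) auto
  \<comment> \<open>One weight has to serve degrees d and Suc d together, since the shadow relates
    their standard monomials.\<close>
  obtain \<omega> :: "'v mono \<Rightarrow> nat" where \<omega>: "\<And>m n. \<omega> (m + n) = \<omega> m + \<omega> n"
    "\<And>i. i \<le> Suc d \<Longrightarrow> inj_on \<omega> {m. mdeg m = i}"
    using exists_monomial_weight by blast
  let ?N = "\<lambda>i. Poly_Mapping.lookup ` standard_monos \<omega> J i"
  have card: "h_vector J i = card (?N i)" if "i \<le> Suc d" for i
    using h_vector_standard_monos[OF sub \<omega>(2)[OF that]]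
    by (simp add: card_image inj_on_subset[OF inj_lookup])
  have sub_monos: "?N i \<subseteq> monos_of UNIV i" for i
    using lookup_image_monos[of i] by (auto simp: standard_monos_def)
  have "card (?N (Suc d)) \<le> mac d (card (shadow (?N (Suc d))))"
    using card_le_mac_shadow[OF sub_monos[of "Suc d", unfolded d]] by (simp add: d)
  also have "\<dots> \<le> mac d (card (?N d))"
  proof (rule mac_mono, rule card_mono)
    show "finite (?N d)" by (rule finite_subset[OF sub_monos finite_monos_of])
    show "shadow (?N (Suc d)) \<subseteq> ?N d" by (rule shadow_standard_monos[OF J \<omega>(1)])
  qed
  finally show "h_vector J (d + 1) \<le> macaulay_bound (h_vector J d) d"
    using card \<open>1 \<le> d\<close> by (simp add: macaulay_bound_eq_mac)
qed

section \<open>The inverse system duality\<close>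

lemma lookup_hom_part:
  "Poly_Mapping.lookup (hom_part d p) m = (if mdeg m = d then Poly_Mapping.lookup p m else 0)"
proof -
  have "Poly_Mapping.lookup (hom_part d p) m
      = (\<Sum>n\<in>{n \<in> Poly_Mapping.keys p. mdeg n = d}. if n = m then Poly_Mapping.lookup p n else 0)"
    unfolding hom_part_def lookup_sum by (rule sum.cong) (auto simp: lookup_single when_def)
  then show ?thesis by (auto simp: in_keys_iff)
qed

lemma hom_part_add: "hom_part d (p + q) = hom_part d p + hom_part d q"
  by (rule poly_mapping_eqI) (simp add: lookup_hom_part lookup_add)

lemma hom_part_zero [simp]: "hom_part d 0 = 0"
  by (rule poly_mapping_eqI) (simp add: lookup_hom_part)

lemma hom_part_in_forms: "hom_part d p \<in> forms d"
  by (simp add: forms_iff lookup_hom_part)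

lemma hom_part_form: "p \<in> forms d \<Longrightarrow> hom_part d' p = (if d' = d then p else 0)"
  by (rule poly_mapping_eqI) (auto simp: forms_iff lookup_hom_part)

lemma single_in_forms: "mdeg m = d \<Longrightarrow> Poly_Mapping.single m c \<in> forms d"
  by (simp add: forms_def)

lemma hom_part_0: "hom_part 0 p = Poly_Mapping.single 0 (Poly_Mapping.lookup p 0)"
  by (rule poly_mapping_eqI) (simp add: lookup_hom_part lookup_single when_def)

lemma mult_in_forms: "p \<in> forms i \<Longrightarrow> q \<in> forms j \<Longrightarrow> p * q \<in> forms (i + j)"
  using keys_mult[of p q] by (fastforce simp: forms_def mdeg_add)

text \<open>A nonzero coefficient certifies that m divides n, so the truncated difference of
  exponents is a true one.\<close>

lemma diff_coeff_nonzero: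
  assumes "diff_coeff m n \<noteq> 0"
  shows "n = m + (n - m)"
proof (rule poly_mapping_eqI)
  fix i
  have "(\<Prod>j<Poly_Mapping.lookup m i. Poly_Mapping.lookup n i - j) \<noteq> 0"
    using assms by (simp add: diff_coeff_def)
  then have "Poly_Mapping.lookup m i \<le> Poly_Mapping.lookup n i"
    by (auto simp: not_less)
  then show "Poly_Mapping.lookup n i = Poly_Mapping.lookup (m + (n - m)) i"
    by (simp add: lookup_add lookup_minus)
qed

lemma diff_coeff_self: "diff_coeff m m \<noteq> 0"
  by (auto simp: diff_coeff_def)

lemma diff_act_in_forms:
  assumes p: "p \<in> forms i" and F: "F \<in> forms j"
  shows "diff_act p F \<in> forms (j - i)" "j < i \<Longrightarrow> diff_act p F = 0"
proof -
  have deg: "diff_coeff m n = 0 \<or> j = i + mdeg (n - m)"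
    if "m \<in> Poly_Mapping.keys p" "n \<in> Poly_Mapping.keys F" for m n
  proof (cases "diff_coeff m n = 0")
    case False
    then have "mdeg n = mdeg m + mdeg (n - m)"
      using diff_coeff_nonzero[of m n] mdeg_add[of m "n - m"] by simp
    then show ?thesis
      using that p F by (simp add: forms_def)
  qed simp
  show "diff_act p F \<in> forms (j - i)"
    unfolding diff_act_def
  proof (intro kvs.subspace_sum[OF subspace_forms])
    fix m n assume "m \<in> Poly_Mapping.keys p" "n \<in> Poly_Mapping.keys F"
    from deg[OF this]
    show "Poly_Mapping.single (n - m) (of_nat (diff_coeff m n) * Poly_Mapping.lookup p m *
        Poly_Mapping.lookup F n) \<in> forms (j - i)"
      by (auto simp: forms_def)
  qed
  show "diff_act p F = 0" if "j < i"
    unfolding diff_act_def by (intro sum.neutral ballI) (use deg that in fastforce)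
qed

text \<open>For j > a the difference a - j would truncate to 0 and select the constant term of p,
  hence the separate zero branch.\<close>

lemma hom_part_diff_act:
  assumes F: "F \<in> forms a"
  shows "hom_part j (diff_act p F) = (if j \<le> a then diff_act (hom_part (a - j) p) F else 0)"
proof (induction p rule: mpoly_induct)
  case (single m c)
  have s: "Poly_Mapping.single m c \<in> forms (mdeg m)" by (rule single_in_forms) simp
  note D = diff_act_in_forms[OF s F]
  show ?case
  proof (cases "a < mdeg m")
    case True
    then show ?thesis using D(2) by (simp add: hom_part_form[OF s])
  next
    case False
    then show ?thesis
      using hom_part_form[OF D(1), of j] by (auto simp: hom_part_form[OF s])
  qed
qed (simp add: diff_act_add_left hom_part_add)

lemma diff_act_const: "diff_act (Poly_Mapping.single 0 c) F = scalar_mult c F"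
proof (induction F rule: mpoly_induct)
  case (single m a)
  then show ?case by (simp add: diff_act_single scalar_mult_single diff_coeff_def)
qed (simp add: diff_act_add_right kvs.scale_right_distrib)

lemma diff_act_scalar_mult: "diff_act (scalar_mult c p) F = scalar_mult c (diff_act p F)"
  using diff_act_mult[of "Poly_Mapping.single 0 c" p F]
  by (simp only: diff_act_const flip: scalar_mult_def)

lemma linear_diff_act: "Vector_Spaces.linear scalar_mult scalar_mult (\<lambda>p. diff_act p F)"
  by unfold_locales (simp_all add: diff_act_add_left diff_act_scalar_mult)

lemma dmod_kvs_subspace: "dmod.subspace N \<Longrightarrow> kvs.subspace N"
  by (simp add: kvs.subspace_def dmod.subspace_def flip: diff_act_const)

section \<open>The derivative pairing\<close>

definition pairing :: "('v::finite, 'k::field_char_0) mpoly \<Rightarrow> ('v, 'k) mpoly \<Rightarrow> 'k" where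
  "pairing p F = Poly_Mapping.lookup (diff_act p F) 0"

lemma pairing_add_left: "pairing (p + q) F = pairing p F + pairing q F"
  by (simp add: pairing_def diff_act_add_left lookup_add)

lemma pairing_add_right: "pairing p (F + G) = pairing p F + pairing p G"
  by (simp add: pairing_def diff_act_add_right lookup_add)

lemma pairing_zero_left [simp]: "pairing 0 F = 0"
  by (simp add: pairing_def)

lemma pairing_scalar_left: "pairing (scalar_mult c p) F = c * pairing p F"
  by (simp add: pairing_def diff_act_scalar_mult)

text \<open>Monomials are orthogonal, and \<open>diff_coeff m m\<close> is the product of the
  factorials of the exponents. That it is nonzero in the field makes the pairing perfect in each
  degree.\<close>

lemma pairing_single: "pairing (Poly_Mapping.single m a) (Poly_Mapping.single n b)
    = (if m = n then of_nat (diff_coeff m m) * a * b else 0)"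
  using diff_coeff_nonzero[of m n]
  by (auto simp: pairing_def diff_act_single lookup_single when_def)

text \<open>R and S share one type, so the pairing is a symmetric form and one notion of complement
  serves both ideals and submodules.\<close>

lemma pairing_commute: "pairing p F = pairing F p"
proof (induction p rule: mpoly_induct)
  case (single m a)
  show ?case
  proof (induction F rule: mpoly_induct)
    case (single n b)
    show ?case by (auto simp: pairing_single)
  qed (simp add: pairing_add_left pairing_add_right)
qed (simp add: pairing_add_left pairing_add_right)

lemma pairing_monomial: "pairing (monomial m) F = of_nat (diff_coeff m m) * Poly_Mapping.lookup F m"
proof (induction F rule: mpoly_induct)
  case (single n b)
  show ?case by (auto simp: pairing_single lookup_single when_def)
qed (simp add: pairing_add_right lookup_add distrib_left)

lemma pairing_nondegenerate:
  assumes "\<And>q. pairing q H = 0"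
  shows "H = 0"
proof (rule poly_mapping_eqI)
  fix m
  have "of_nat (diff_coeff m m) * Poly_Mapping.lookup H m = 0"
    using assms pairing_monomial[of m H] by simp
  then show "Poly_Mapping.lookup H m = Poly_Mapping.lookup 0 m"
    using diff_coeff_self[of m] by simp
qed

lemma pairing_hom_part: "F \<in> forms i \<Longrightarrow> pairing (hom_part i p) F = pairing p F"
  using hom_part_diff_act[of F i 0 p] lookup_hom_part[of 0 "diff_act p F" 0]
  by (simp add: pairing_def)

lemma pairing_diff_act: "pairing q (diff_act p F) = pairing (q * p) F"
  by (simp add: pairing_def diff_act_mult)

lemma form_expansion:
  assumes "F \<in> forms i"
  shows "F = (\<Sum>m | mdeg m = i. scalar_mult (Poly_Mapping.lookup F m) (monomial m))"
proof -
  have "F = (\<Sum>m\<in>Poly_Mapping.keys F. scalar_mult (Poly_Mapping.lookup F m) (monomial m))"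
    by (rule monomial_expansion)
  also have "\<dots> = (\<Sum>m | mdeg m = i. scalar_mult (Poly_Mapping.lookup F m) (monomial m))"
    by (rule sum.mono_neutral_left[OF finite_monomials])
      (use assms in \<open>auto simp: forms_def in_keys_iff\<close>)
  finally show ?thesis .
qed

lemma pairing_sum_left: "pairing (sum f A) F = (\<Sum>a\<in>A. pairing (f a) F)"
  by (induction A rule: infinite_finite_induct) (simp_all add: pairing_add_left)

lemma functional_is_pairing:
  fixes g :: "('v::finite, 'k::field_char_0) mpoly \<Rightarrow> 'k"
  assumes g: "Vector_Spaces.linear scalar_mult (*) g"
  obtains p where "p \<in> forms i" "\<And>F. F \<in> forms i \<Longrightarrow> pairing p F = g F"
proof -
  interpret g: Vector_Spaces.linear scalar_mult "(*)" g by (rule g)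
  \<comment> \<open>The division cancels the norm of the monomial m.\<close>
  define p where "p = (\<Sum>m | mdeg m = i.
      scalar_mult (g (monomial m) / of_nat (diff_coeff m m)) (monomial m))"
  show thesis
  proof
    show "p \<in> forms i"
      unfolding p_def
      by (intro kvs.subspace_sum[OF subspace_forms] kvs.subspace_scale[OF subspace_forms])
        (simp add: single_in_forms)
    fix F :: "('v, 'k) mpoly" assume F: "F \<in> forms i"
    have "pairing p F = (\<Sum>m | mdeg m = i. Poly_Mapping.lookup F m * g (monomial m))"
      unfolding p_def pairing_sum_left
      by (rule sum.cong) (simp_all add: pairing_scalar_left pairing_monomial diff_coeff_self)
    also have "\<dots> = g (\<Sum>m | mdeg m = i. scalar_mult (Poly_Mapping.lookup F m) (monomial m))"
      by (simp add: g.sum g.scale)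
    finally show "pairing p F = g F"
      by (simp flip: form_expansion[OF F])
  qed
qed

section \<open>Orthogonal complements and Hilbert functions\<close>

definition perp :: "nat \<Rightarrow> ('v::finite, 'k::field_char_0) mpoly set \<Rightarrow> ('v, 'k) mpoly set" where
  "perp i W = {p \<in> forms i. \<forall>w\<in>W. pairing p w = 0}"

lemma subspace_perp: "kvs.subspace (perp i W)"
proof (rule kvs.subspaceI)
  show "0 \<in> perp i W"
    using kvs.subspace_0[OF subspace_forms] by (simp add: perp_def)
qed (auto simp: perp_def pairing_add_left pairing_scalar_left
    intro: kvs.subspace_add[OF subspace_forms] kvs.subspace_scale[OF subspace_forms])

text \<open>Forms dual to a basis C of W give a basis modulo the complement: subtracting from q the
  combination r of dual forms with coefficients \<open>pairing q c\<close> leaves a form orthogonal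
  to W.\<close>

lemma quot_dim_perp:
  fixes W :: "('v::finite, 'k::field_char_0) mpoly set"
  assumes W: "kvs.subspace W" "W \<subseteq> forms i"
  shows "quot_dim (forms i) (perp i W) = kvs.dim W"
proof -
  interpret vp: vector_space_pair "scalar_mult :: 'k \<Rightarrow> ('v, 'k) mpoly \<Rightarrow> _" "(*) :: 'k \<Rightarrow> 'k \<Rightarrow> 'k"
    by unfold_locales (simp_all add: algebra_simps)
  obtain C where C: "C \<subseteq> W" "kvs.independent C" "W \<subseteq> kvs.span C" "card C = kvs.dim W"
    by (rule kvs.basis_exists)
  have "C \<subseteq> kvs.span (monomial ` {m. mdeg m = i})"
    using C(1) W(2) forms_subset_span by blast
  then have finC: "finite C"
    using kvs.independent_span_bound[OF finite_imageI[OF finite_monomials] C(2)] by blast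
  have "\<exists>p. p \<in> forms i \<and> (\<forall>c'\<in>C. pairing p c' = (if c' = c then 1 else 0))" if "c \<in> C" for c
  proof -
    obtain g where g: "Vector_Spaces.linear scalar_mult (*) g" "\<forall>x\<in>C. g x = (if x = c then 1 else 0)"
      using vp.linear_independent_extend[OF C(2), of "\<lambda>x. if x = c then 1 else 0"] by blast
    obtain p where "p \<in> forms i" "\<And>F. F \<in> forms i \<Longrightarrow> pairing p F = g F"
      using functional_is_pairing[OF g(1)] by blast
    then show ?thesis using g(2) C(1) W(2) by (intro exI[of _ p]) auto
  qed
  then obtain p where p: "\<And>c. c \<in> C \<Longrightarrow> p c \<in> forms i"
    "\<And>c c'. c \<in> C \<Longrightarrow> c' \<in> C \<Longrightarrow> pairing (p c) c' = (if c' = c then 1 else 0)"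
    by metis
  have inj: "inj_on p C"
    by (rule inj_onI) (metis p(2) zero_neq_one)
  have "quot_basis (forms i) (perp i W) (p ` C)"
    unfolding quot_basis_def
  proof (intro conjI ballI subsetI)
    fix b assume "b \<in> p ` C"
    then show "b \<in> forms i" using p(1) by blast
  next
    fix b assume "b \<in> p ` C"
    then obtain c where c: "c \<in> C" "b = p c" by blast
    have "kvs.subspace {q. pairing q c = 0}"
      by (rule kvs.subspaceI) (simp_all add: pairing_add_left pairing_scalar_left)
    moreover have "perp i W \<union> (p ` C - {b}) \<subseteq> {q. pairing q c = 0}"
      using c C(1) p(2) by (auto simp: perp_def)
    ultimately have "kvs.span (perp i W \<union> (p ` C - {b})) \<subseteq> {q. pairing q c = 0}"
      by (intro kvs.span_minimal)
    moreover have "pairing b c = 1" using c p(2) by simp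
    ultimately show "b \<notin> kvs.span (perp i W \<union> (p ` C - {b}))" by force
  next
    fix q :: "('v, 'k) mpoly" assume q: "q \<in> forms i"
    define r where "r = (\<Sum>c\<in>C. scalar_mult (pairing q c) (p c))"
    have rC: "pairing r c = pairing q c" if "c \<in> C" for c
      unfolding r_def pairing_sum_left using that finC
      by (simp add: pairing_scalar_left p(2) if_distrib cong: if_cong)
    have "r \<in> forms i"
      unfolding r_def
      by (intro kvs.subspace_sum[OF subspace_forms] kvs.subspace_scale[OF subspace_forms] p(1))
    then have "q - r \<in> forms i"
      using kvs.subspace_diff[OF subspace_forms q] by blast
    moreover have "pairing (q - r) w = 0" if "w \<in> W" for w
    proof -
      have "pairing (q - r) c = 0" if "c \<in> C" for c
        using rC[OF that] pairing_add_left[of "q - r" r c] by simp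
      then have "C \<subseteq> {w. pairing (q - r) w = 0}" by blast
      moreover have "kvs.subspace {w. pairing (q - r) w = 0}"
        by (subst pairing_commute, rule kvs.subspaceI)
          (simp_all add: pairing_add_left pairing_scalar_left)
      ultimately have "kvs.span C \<subseteq> {w. pairing (q - r) w = 0}"
        by (rule kvs.span_minimal)
      then show ?thesis using C(3) that by blast
    qed
    ultimately have "q - r \<in> perp i W" by (simp add: perp_def)
    then have 1: "q - r \<in> kvs.span (perp i W \<union> p ` C)"
      by (intro kvs.span_base) simp
    have 2: "r \<in> kvs.span (perp i W \<union> p ` C)"
      unfolding r_def by (intro kvs.span_sum kvs.span_scale kvs.span_base) simp
    show "q \<in> kvs.span (perp i W \<union> p ` C)"
      using kvs.span_add[OF 1 2] by simp
  qed
  then have "quot_dim (forms i) (perp i W) = card (p ` C)"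
    by (rule quot_dim_eq_card[OF _ subspace_perp _ subspace_forms
          finite_imageI[OF finite_monomials] forms_subset_span]) (auto simp: perp_def)
  then show ?thesis using C(4) card_image[OF inj] by simp
qed

definition graded_submodule :: "('v::finite, 'k::field_char_0) mpoly set \<Rightarrow> bool" where
  "graded_submodule N \<longleftrightarrow> dmod.subspace N \<and> (\<forall>x\<in>N. \<forall>j. hom_part j x \<in> N)"

text \<open>Orthogonality to the degree i part suffices: pairing q with px equals pairing p with qx,
  the submodule contains qx and its homogeneous parts, and only the part of degree i pairs with
  p.\<close>

lemma ann_forms:
  assumes "graded_submodule N"
  shows "ann N \<inter> forms i = perp i (N \<inter> forms i)"
proof
  show "ann N \<inter> forms i \<subseteq> perp i (N \<inter> forms i)"
    by (auto simp: ann_def perp_def pairing_def)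
  show "perp i (N \<inter> forms i) \<subseteq> ann N \<inter> forms i"
  proof
    fix p assume "p \<in> perp i (N \<inter> forms i)"
    then have p: "p \<in> forms i" "\<And>w. w \<in> N \<inter> forms i \<Longrightarrow> pairing p w = 0"
      by (auto simp: perp_def)
    have "diff_act p x = 0" if x: "x \<in> N" for x
    proof (rule pairing_nondegenerate)
      fix q
      have "diff_act q x \<in> N"
        using assms x dmod.subspace_scale by (auto simp: graded_submodule_def)
      then have "hom_part i (diff_act q x) \<in> N \<inter> forms i"
        using assms by (simp add: graded_submodule_def hom_part_in_forms)
      then have "pairing p (hom_part i (diff_act q x)) = 0" by (rule p(2))
      then have "pairing p (diff_act q x) = 0"
        using pairing_hom_part[OF p(1), of "diff_act q x"] by (simp add: pairing_commute[of _ p])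
      then show "pairing q (diff_act p x) = 0"
        by (simp add: pairing_diff_act mult.commute)
    qed
    then show "p \<in> ann N \<inter> forms i" using p(1) by (simp add: ann_def)
  qed
qed

lemma inverse_system_forms:
  assumes "homogeneous_ideal I"
  shows "inverse_system I \<inter> forms i = perp i (I \<inter> forms i)"
proof
  show "inverse_system I \<inter> forms i \<subseteq> perp i (I \<inter> forms i)"
    by (auto simp: inverse_system_def perp_def pairing_def pairing_commute)
      (metis lookup_zero pairing_commute pairing_def)
  show "perp i (I \<inter> forms i) \<subseteq> inverse_system I \<inter> forms i"
  proof
    fix F assume "F \<in> perp i (I \<inter> forms i)"
    then have F: "F \<in> forms i" "\<And>w. w \<in> I \<inter> forms i \<Longrightarrow> pairing w F = 0"
      by (auto simp: perp_def pairing_commute)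
    have "diff_act p F = 0" if p: "p \<in> I" for p
    proof (rule pairing_nondegenerate)
      fix q
      have "q * p \<in> I"
        using assms p rmod.subspace_scale by (auto simp: homogeneous_ideal_def)
      then have "hom_part i (q * p) \<in> I \<inter> forms i"
        using assms by (simp add: homogeneous_ideal_def hom_part_in_forms)
      then have "pairing (hom_part i (q * p)) F = 0" by (rule F(2))
      then show "pairing q (diff_act p F) = 0"
        using pairing_hom_part[OF F(1)] by (simp add: pairing_diff_act)
    qed
    then show "F \<in> inverse_system I \<inter> forms i" using F(1) by (simp add: inverse_system_def)
  qed
qed

lemma h_vector_ann:
  assumes "graded_submodule N"
  shows "h_vector (ann N) i = kvs.dim (N \<inter> forms i)"
  unfolding h_vector_def ann_forms[OF assms]
  using assms dmod_kvs_subspace kvs.subspace_inter subspace_forms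
  by (intro quot_dim_perp) (auto simp: graded_submodule_def)

text \<open>The degree i part of the inverse system is the complement of that of I, so its dimension
  is the codimension of I in degree i.\<close>

lemma h_vector_inverse_system:
  fixes I :: "('v::finite, 'k::field_char_0) mpoly set"
  assumes "homogeneous_ideal I"
  shows "h_vector I i = kvs.dim (inverse_system I \<inter> forms i)"
proof -
  have sub: "kvs.subspace (I \<inter> forms i)"
    using assms ideal_kvs_subspace kvs.subspace_inter subspace_forms
    by (auto simp: homogeneous_ideal_def)
  have "perp i (I \<inter> forms i) \<subseteq> forms i" by (auto simp: perp_def)
  then have "kvs.dim (I \<inter> forms i) + kvs.dim (perp i (I \<inter> forms i)) = kvs.dim (forms i :: ('v, 'k) mpoly set)"
    using quot_dim_forms_add[OF subspace_perp _ subspace_forms order_refl, of i "I \<inter> forms i" i]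
      quot_dim_perp[OF sub, of i]
    by simp
  moreover have "h_vector I i + kvs.dim (I \<inter> forms i) = kvs.dim (forms i :: ('v, 'k) mpoly set)"
    unfolding h_vector_def by (rule quot_dim_forms_add[OF sub _ subspace_forms order_refl]) simp
  ultimately show ?thesis by (simp add: inverse_system_forms[OF assms])
qed

section \<open>Level algebras of type two\<close>

lemma dim_subspace_le:
  assumes "kvs.subspace U" "U \<subseteq> V" "kvs.subspace V" "finite X" "V \<subseteq> kvs.span X"
  shows "kvs.dim U \<le> kvs.dim V" "kvs.dim U = kvs.dim V \<Longrightarrow> U = V"
proof -
  obtain C where C: "C \<subseteq> U" "kvs.independent C" "U \<subseteq> kvs.span C" "card C = kvs.dim U"
    by (rule kvs.basis_exists)
  have "C \<subseteq> V" using C(1) assms(2) by blast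
  then obtain D where D: "C \<subseteq> D" "D \<subseteq> V" "kvs.independent D" "V \<subseteq> kvs.span D"
    using kvs.maximal_independent_subset_extend[OF _ C(2)] by blast
  have "D \<subseteq> kvs.span X" using D(2) assms(5) by blast
  then have fin: "finite D"
    using kvs.independent_span_bound[OF assms(4) D(3)] by blast
  have card: "card D = kvs.dim V" by (rule kvs.basis_card_eq_dim[OF D(2,4,3)])
  show "kvs.dim U \<le> kvs.dim V" using card_mono[OF fin D(1)] card C(4) by simp
  assume "kvs.dim U = kvs.dim V"
  then have "C = D" using card_subset_eq[OF fin D(1)] card C(4) by simp
  moreover have "kvs.span C \<subseteq> U" using C(1) assms(1) by (rule kvs.span_minimal)
  ultimately show "U = V" using D(4) assms(2) by blast
qed

lemma dim_zero: "kvs.dim {0} = 0"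
  using kvs.dim_span_eq_card_independent[OF kvs.independent_empty] by simp

lemma h_vector_eq_0:
  fixes I :: "('v::finite, 'k::field_char_0) mpoly set"
  assumes "kvs.subspace I" "h_vector I i = 0"
  shows "forms i \<subseteq> I"
proof -
  note sub = kvs.subspace_inter[OF assms(1) subspace_forms, of i]
  have "kvs.dim (I \<inter> forms i) = kvs.dim (forms i :: ('v, 'k) mpoly set)"
    using quot_dim_forms_add[OF sub Int_lower2 subspace_forms order_refl] assms(2)
    by (simp add: h_vector_def)
  then have "I \<inter> forms i = forms i"
    using dim_subspace_le(2)[OF sub _ subspace_forms finite_imageI[OF finite_monomials] forms_subset_span]
    by blast
  then show ?thesis by blast
qed

lemma h_vector_0_if_forms_subset:
  assumes "forms i \<subseteq> I"
  shows "h_vector I i = 0"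
proof -
  have "I \<inter> forms i = forms i" using assms by blast
  then show ?thesis
    using quot_dim_forms_add[OF subspace_forms order_refl subspace_forms order_refl, of i]
    by (simp add: h_vector_def)
qed

text \<open>Every ideal of the chain contains all forms of degree above e, so it is determined by
  its intersection with the finite-dimensional span of the lower monomials. Once the dimension of
  this intersection is minimal, the chain is constant.\<close>

lemma artinian_quotientI:
  fixes I :: "('v::finite, 'k::field_char_0) mpoly set"
  assumes high: "\<And>i. e < i \<Longrightarrow> forms i \<subseteq> I"
  shows "artinian_quotient I"
  unfolding artinian_quotient_def
proof (intro allI impI)
  fix J :: "nat \<Rightarrow> ('v, 'k) mpoly set"
  assume J: "\<forall>n. module.subspace (*) (J n) \<and> I \<subseteq> J n \<and> J (Suc n) \<subseteq> J n"
  define X :: "('v, 'k) mpoly set" where "X = monomial ` {m. mdeg m \<le> e}"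
  have "{m :: 'v mono. mdeg m \<le> e} = (\<Union>i\<le>e. {m. mdeg m = i})" by auto
  then have finX: "finite X" by (simp add: X_def finite_monomials)
  define V where "V n = J n \<inter> kvs.span X" for n
  have Jsub: "kvs.subspace (J n)" for n by (rule ideal_kvs_subspace) (use J in simp)
  then have V: "kvs.subspace (V n)" for n by (simp add: V_def kvs.subspace_inter)
  have VX: "V n \<subseteq> kvs.span X" for n by (simp add: V_def)
  obtain n where n: "\<And>m. kvs.dim (V n) \<le> kvs.dim (V m)"
    using ex_has_least_nat[of "\<lambda>_. True" 0 "\<lambda>n. kvs.dim (V n)"] by auto
  have "J m = J n" if "n \<le> m" for m
  proof
    show sub: "J m \<subseteq> J n"
      by (rule lift_Suc_antimono_le[of J, OF _ that]) (use J in simp)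
    then have Vsub: "V m \<subseteq> V n" by (auto simp: V_def)
    have "kvs.dim (V m) = kvs.dim (V n)"
      using dim_subspace_le(1)[OF V Vsub V finX VX] n[of m] by simp
    then have Veq: "V m = V n" by (rule dim_subspace_le(2)[OF V Vsub V finX VX])
    show "J n \<subseteq> J m"
    proof
      fix p assume p: "p \<in> J n"
      let ?t = "\<lambda>m. scalar_mult (Poly_Mapping.lookup p m) (monomial m)"
      let ?K = "Poly_Mapping.keys p"
      define low where "low = (\<Sum>m\<in>?K \<inter> {m. mdeg m \<le> e}. ?t m)"
      define high' where "high' = (\<Sum>m\<in>?K - {m. mdeg m \<le> e}. ?t m)"
      have eq: "p = low + high'"
        using monomial_expansion[of p] sum.Int_Diff[of ?K ?t "{m. mdeg m \<le> e}"]
        by (simp add: low_def high'_def)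
      have mono_J: "monomial m \<in> J k" if "e < mdeg m" for m k
        using high[OF that] J single_in_forms[of m "mdeg m" 1] by blast
      have hi: "high' \<in> J k" for k
        unfolding high'_def
        by (intro kvs.subspace_sum[OF Jsub] kvs.subspace_scale[OF Jsub] mono_J) auto
      have "low \<in> kvs.span X"
        unfolding low_def X_def by (intro kvs.span_sum kvs.span_scale kvs.span_base) auto
      moreover have "low \<in> J n"
        using kvs.subspace_diff[OF Jsub p hi] eq by simp
      ultimately have "low \<in> J m" using Veq by (auto simp: V_def)
      then show "p \<in> J m" using eq kvs.subspace_add[OF Jsub _ hi] by simp
    qed
  qed
  then show "\<exists>n. \<forall>m\<ge>n. J m = J n" by blast
qed

lemma Var_mult_monomial:
  assumes "0 < Poly_Mapping.lookup m i"
  shows "monomial m = monomial (m - Poly_Mapping.single i 1) * Var i"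
proof -
  have "m - Poly_Mapping.single i 1 + Poly_Mapping.single i 1 = m"
    using assms
    by (intro poly_mapping_eqI) (auto simp: lookup_add lookup_minus lookup_single when_def)
  then show ?thesis by (simp add: Var_def mult_single)
qed

lemma Var_in_forms: "Var i \<in> forms 1"
  by (simp add: Var_def single_in_forms)

lemma socle_ideal_iff:
  fixes I :: "('v, 'k::field_char_0) mpoly set"
  assumes "rmod.subspace I"
  shows "p \<in> socle_ideal I \<longleftrightarrow> (\<forall>i. Var i * p \<in> I)"
proof
  assume "p \<in> socle_ideal I"
  moreover have "(Var i :: ('v, 'k) mpoly) \<in> max_ideal" for i
    unfolding max_ideal_def by (rule rmod.span_base) simp
  ultimately show "\<forall>i. Var i * p \<in> I" by (simp add: socle_ideal_def)
next
  assume v: "\<forall>i. Var i * p \<in> I"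
  have "rmod.subspace {q. q * p \<in> I}"
  proof (rule rmod.subspaceI)
    fix c q assume "q \<in> {q. q * p \<in> I}"
    then show "c * q \<in> {q. q * p \<in> I}"
      using rmod.subspace_scale[OF assms, of "q * p" c] by (simp add: rmod.scale_scale)
  qed (simp_all add: rmod.subspace_0[OF assms] rmod.subspace_add[OF assms] distrib_right)
  then have "rmod.span (range Var) \<subseteq> {q. q * p \<in> I}"
    using v by (intro rmod.span_minimal) auto
  then show "p \<in> socle_ideal I" by (auto simp: socle_ideal_def max_ideal_def)
qed

lemma socle_vector_top:
  fixes I :: "('v::finite, 'k::field_char_0) mpoly set"
  assumes "rmod.subspace I" "forms (Suc e) \<subseteq> I"
  shows "socle_vector I e = h_vector I e"
proof -
  have "forms e \<subseteq> socle_ideal I"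
  proof
    fix p :: "('v, 'k) mpoly" assume "p \<in> forms e"
    then have "Var i * p \<in> forms (Suc e)" for i
      using mult_in_forms[OF Var_in_forms, of p e] by simp
    then show "p \<in> socle_ideal I" using assms by (auto simp: socle_ideal_iff)
  qed
  then have "socle_ideal I \<inter> forms e = forms e" by blast
  then show ?thesis by (simp add: socle_vector_def h_vector_def)
qed

text \<open>Every monomial other than 1 is a multiple of a variable and so pairs to zero with H;
  positive degree excludes a constant term.\<close>

lemma zero_if_derivatives_zero:
  assumes "\<And>i. diff_act (Var i) H = 0" "H \<in> forms d" "0 < d"
  shows "H = 0"
proof (rule poly_mapping_eqI)
  fix m
  show "Poly_Mapping.lookup H m = Poly_Mapping.lookup 0 m"
  proof (cases "m = 0")
    case True
    then have "mdeg m = 0" by simp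
    then have "mdeg m \<noteq> d" using assms(3) by linarith
    then show ?thesis using assms(2) by (auto simp: forms_iff)
  next
    case False
    then obtain i where "Poly_Mapping.lookup m i \<noteq> 0"
      by (metis lookup_zero poly_mapping_eqI)
    then have "monomial m = monomial (m - Poly_Mapping.single i 1) * Var i"
      by (intro Var_mult_monomial) simp
    then have "diff_act (monomial m) H = diff_act (monomial (m - Poly_Mapping.single i 1) * Var i) H"
      by (rule arg_cong)
    also have "\<dots> = diff_act (monomial (m - Poly_Mapping.single i 1)) (diff_act (Var i) H)"
      by (simp only: diff_act_mult)
    finally have "pairing (monomial m) H = 0"
      by (simp add: assms(1) pairing_def)
    then show ?thesis
      using diff_coeff_self[of m] by (simp add: pairing_monomial)
  qed
qed

section \<open>Submodules generated by forms and their annihilators\<close>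

lemma mem_span_singleton: "x \<in> dmod.span {F} \<longleftrightarrow> (\<exists>p. x = diff_act p F)"
  by (auto simp: dmod.span_singleton)

lemma mem_span_pair: "x \<in> dmod.span {F, G} \<longleftrightarrow> (\<exists>p q. x = diff_act p F + diff_act q G)"
  unfolding insert_is_Un[of F "{G}"] dmod.span_Un by (auto simp: mem_span_singleton)

lemma diff_act_in_span: "diff_act p F \<in> dmod.span {F}"
  by (auto simp: mem_span_singleton)

lemma graded_submoduleD: "graded_submodule N \<Longrightarrow> x \<in> N \<Longrightarrow> hom_part j x \<in> N"
  by (simp add: graded_submodule_def)

lemma graded_span_singleton:
  assumes "F \<in> forms a"
  shows "graded_submodule (dmod.span {F})"
  unfolding graded_submodule_def
proof (intro conjI ballI allI)
  fix x j assume "x \<in> dmod.span {F}"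
  then obtain p where "x = diff_act p F" by (auto simp: mem_span_singleton)
  then have "hom_part j x = diff_act (if j \<le> a then hom_part (a - j) p else 0) F"
    by (simp add: hom_part_diff_act[OF assms])
  then show "hom_part j x \<in> dmod.span {F}" by (simp only: diff_act_in_span)
qed simp

lemma graded_span_pair:
  assumes "F \<in> forms a" "G \<in> forms b"
  shows "graded_submodule (dmod.span {F, G})"
  unfolding graded_submodule_def
proof (intro conjI ballI allI)
  fix x j assume "x \<in> dmod.span {F, G}"
  then obtain p q where "x = diff_act p F + diff_act q G"
    by (auto simp: mem_span_pair)
  moreover have "hom_part j (diff_act p F) \<in> dmod.span {F}" "hom_part j (diff_act q G) \<in> dmod.span {G}"
    by (rule graded_submoduleD[OF graded_span_singleton diff_act_in_span], fact assms)+
  ultimately show "hom_part j x \<in> dmod.span {F, G}"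
    unfolding mem_span_singleton mem_span_pair by (metis hom_part_add)
qed simp

text \<open>Covers both kinds of ideals used here: N = 0 gives the annihilator of F, and N generated
  by G gives the colon ideal.\<close>

lemma homogeneous_preimage:
  assumes F: "F \<in> forms a" and N: "graded_submodule N"
  shows "homogeneous_ideal {p. diff_act p F \<in> N}"
proof -
  have sub: "dmod.subspace N" using N by (simp add: graded_submodule_def)
  have "rmod.subspace {p. diff_act p F \<in> N}"
  proof (rule rmod.subspaceI)
    fix c p assume "p \<in> {p. diff_act p F \<in> N}"
    then show "c * p \<in> {p. diff_act p F \<in> N}"
      using dmod.subspace_scale[OF sub, of "diff_act p F" c] by simp
  qed (use dmod.subspace_0[OF sub] dmod.subspace_add[OF sub] in \<open>auto simp: diff_act_add_left\<close>)
  moreover have "diff_act (hom_part d p) F \<in> N" if "diff_act p F \<in> N" for p d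
  proof (cases "d \<le> a")
    case True
    then have "diff_act (hom_part d p) F = hom_part (a - d) (diff_act p F)"
      by (simp add: hom_part_diff_act[OF F])
    then show ?thesis using N that by (simp add: graded_submodule_def)
  next
    case False
    then have "diff_act (hom_part d p) F = 0"
      by (intro diff_act_in_forms(2)[OF hom_part_in_forms F]) simp
    then show ?thesis using dmod.subspace_0[OF sub] by simp
  qed
  ultimately show ?thesis by (simp add: homogeneous_ideal_def)
qed

lemma ann_span_singleton: "ann (dmod.span {F}) = {p. diff_act p F = 0}"
proof
  show "ann (dmod.span {F}) \<subseteq> {p. diff_act p F = 0}"
    using dmod.span_base[of F "{F}"] by (auto simp: ann_def)
  show "{p. diff_act p F = 0} \<subseteq> ann (dmod.span {F})"
  proof
    fix p assume "p \<in> {p. diff_act p F = 0}"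
    then have "diff_act (q * p) F = 0" for q
      using diff_act_mult[of q p F] by (simp only: mem_Collect_eq dmod.scale_zero_right)
    then show "p \<in> ann (dmod.span {F})"
      by (auto simp: ann_def mem_span_singleton mult.commute)
  qed
qed

lemma forms_subset_ann: "F \<in> forms e \<Longrightarrow> e < i \<Longrightarrow> forms i \<subseteq> ann (dmod.span {F})"
  using diff_act_in_forms(2) by (auto simp: ann_span_singleton)

lemma homogeneous_ann:
  assumes "F \<in> forms a"
  shows "homogeneous_ideal (ann (dmod.span {F}))"
proof -
  have "graded_submodule {0}" by (simp add: graded_submodule_def)
  then show ?thesis
    using homogeneous_preimage[OF assms, of "{0}"] by (simp add: ann_span_singleton)
qed

lemma span_singleton_top:
  assumes "F \<in> forms e"
  shows "dmod.span {F} \<inter> forms e = kvs.span {F}"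
proof
  show "dmod.span {F} \<inter> forms e \<subseteq> kvs.span {F}"
  proof
    fix x assume x: "x \<in> dmod.span {F} \<inter> forms e"
    then obtain p where "x = diff_act p F" by (auto simp: mem_span_singleton)
    then have "x = diff_act (hom_part 0 p) F"
      using x hom_part_diff_act[OF assms, of e p] hom_part_form[of x e e] by simp
    then show "x \<in> kvs.span {F}"
      by (simp add: hom_part_0 diff_act_const kvs.span_scale kvs.span_base)
  qed
  show "kvs.span {F} \<subseteq> dmod.span {F} \<inter> forms e"
    using assms kvs.subspace_scale[OF subspace_forms assms]
    by (auto simp: kvs.span_singleton mem_span_singleton simp flip: diff_act_const)
qed

lemma dim_singleton: "F \<noteq> 0 \<Longrightarrow> kvs.dim {F} = 1"
  using kvs.dim_eq_card_independent[of "{F}"] by simp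

text \<open>If all variables carry a form p of degree i < e into the annihilator, then all first
  derivatives of pF vanish while its degree e - i is positive; so pF = 0. In degree e the module is
  the line spanned by F.\<close>

lemma gorenstein_ann:
  assumes F: "F \<in> forms e" "F \<noteq> 0"
  shows "gorenstein (ann (dmod.span {F}))"
proof -
  let ?A = "ann (dmod.span {F})"
  have hom: "homogeneous_ideal ?A" using F(1) by (rule homogeneous_ann)
  then have sub: "rmod.subspace ?A" by (simp add: homogeneous_ideal_def)
  have high: "forms i \<subseteq> ?A" if "e < i" for i
    using F(1) that by (rule forms_subset_ann)
  have top: "h_vector ?A e = 1"
    by (simp add: h_vector_ann graded_span_singleton[OF F(1)] span_singleton_top[OF F(1)]
        dim_singleton[OF F(2)])
  have "h_vector ?A i = 0" if "e < i" for i
    using high[OF that] by (rule h_vector_0_if_forms_subset)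
  moreover have "socle_vector ?A i = 0" if "i < e" for i
  proof -
    have "socle_ideal ?A \<inter> forms i = ?A \<inter> forms i"
    proof
      show "?A \<inter> forms i \<subseteq> socle_ideal ?A \<inter> forms i"
        using rmod.subspace_scale[OF sub] by (auto simp: socle_ideal_def)
      show "socle_ideal ?A \<inter> forms i \<subseteq> ?A \<inter> forms i"
      proof
        fix p assume p: "p \<in> socle_ideal ?A \<inter> forms i"
        then have "diff_act (Var j) (diff_act p F) = 0" for j
          using sub by (simp add: socle_ideal_iff ann_span_singleton)
        moreover have "diff_act p F \<in> forms (e - i)"
          using p F(1) diff_act_in_forms(1) by blast
        ultimately have "diff_act p F = 0"
          by (rule zero_if_derivatives_zero) (use that in simp)
        then show "p \<in> ?A \<inter> forms i" using p by (simp add: ann_span_singleton)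
      qed
    qed
    moreover have "kvs.subspace (?A \<inter> forms i)"
      by (rule kvs.subspace_inter[OF ideal_kvs_subspace[OF sub] subspace_forms])
    ultimately show ?thesis
      using quot_dim_forms_add[of "?A \<inter> forms i" "?A \<inter> forms i" i]
      by (simp add: socle_vector_def)
  qed
  ultimately have "level_algebra ?A e 1"
    using hom artinian_quotientI[OF high] top socle_vector_top[OF sub high]
    by (simp add: level_algebra_def socle_degree_def)
  then show ?thesis by (auto simp: gorenstein_def)
qed

section \<open>Hilbert functions of sums and colon ideals\<close>

lemma h_vector_sum_ideal:
  fixes A B :: "('v::finite, 'k::field_char_0) mpoly set"
  assumes A: "homogeneous_ideal A" and B: "homogeneous_ideal B"
  shows "homogeneous_ideal (rmod.span (A \<union> B))"
    and "h_vector (rmod.span (A \<union> B)) i + h_vector (A \<inter> B) i = h_vector A i + h_vector B i"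
proof -
  let ?K = "rmod.span (A \<union> B)"
  have sub: "rmod.subspace A" "rmod.subspace B"
    and part: "\<And>p d. p \<in> A \<Longrightarrow> hom_part d p \<in> A" "\<And>p d. p \<in> B \<Longrightarrow> hom_part d p \<in> B"
    using A B by (auto simp: homogeneous_ideal_def)
  have "rmod.span A = A" "rmod.span B = B" using sub by simp_all
  then have K: "?K = {x + y |x y. x \<in> A \<and> y \<in> B}"
    by (simp only: rmod.span_Un)
  show "homogeneous_ideal ?K"
    unfolding homogeneous_ideal_def
  proof (intro conjI ballI allI)
    fix p d assume "p \<in> ?K"
    then obtain x y where "x \<in> A" "y \<in> B" "p = x + y" unfolding K by blast
    then have "hom_part d x \<in> A" "hom_part d y \<in> B" "hom_part d p = hom_part d x + hom_part d y"
      using part by (simp_all add: hom_part_add)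
    then show "hom_part d p \<in> ?K" unfolding K by blast
  qed simp
  have kv: "kvs.subspace A" "kvs.subspace B" "kvs.subspace ?K"
    using sub ideal_kvs_subspace by auto
  note int = kvs.subspace_inter[OF _ subspace_forms, of _ i]
  note fin = finite_imageI[OF finite_monomials[of i]]
  have "A \<inter> B \<inter> forms i = {v \<in> A \<inter> forms i. v \<in> B \<inter> forms i}" by blast
  \<comment> \<open>The second isomorphism theorem in degree i: A / (A \<inter> B) and (A + B) / B
    have the same dimension.\<close>
  then have "quot_dim (A \<inter> forms i) (A \<inter> B \<inter> forms i) = quot_dim (?K \<inter> forms i) (B \<inter> forms i)"
  proof (elim ssubst)
    show "quot_dim (A \<inter> forms i) {v \<in> A \<inter> forms i. v \<in> B \<inter> forms i}
      = quot_dim (?K \<inter> forms i) (B \<inter> forms i)"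
    proof (rule quot_dim_preimage[where T = "\<lambda>v. v" and X = "monomial ` {m. mdeg m = i}"
          and Y = "monomial ` {m. mdeg m = i}"])
      show "Vector_Spaces.linear scalar_mult scalar_mult (\<lambda>v. v)"
        by (rule kvs.linear_ident)
      show "A \<inter> forms i \<subseteq> kvs.span (monomial ` {m. mdeg m = i})"
        "?K \<inter> forms i \<subseteq> kvs.span (monomial ` {m. mdeg m = i})"
        using forms_subset_span by blast+
      show "(\<lambda>v. v) ` (A \<inter> forms i) \<subseteq> ?K \<inter> forms i" "B \<inter> forms i \<subseteq> ?K \<inter> forms i"
        using rmod.span_superset[of "A \<union> B"] by auto
      show "?K \<inter> forms i \<subseteq> kvs.span ((\<lambda>v. v) ` (A \<inter> forms i) \<union> (B \<inter> forms i))"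
      proof
        fix x assume x: "x \<in> ?K \<inter> forms i"
        then obtain p q where pq: "p \<in> A" "q \<in> B" "x = p + q" unfolding K by blast
        then have "x = hom_part i p + hom_part i q"
          using x hom_part_form[of x i i] by (simp add: hom_part_add)
        moreover have "hom_part i p \<in> A \<inter> forms i \<union> B \<inter> forms i" "hom_part i q \<in> A \<inter> forms i \<union> B \<inter> forms i"
          using part pq(1,2) hom_part_in_forms by blast+
        ultimately show "x \<in> kvs.span ((\<lambda>v. v) ` (A \<inter> forms i) \<union> (B \<inter> forms i))"
          by (simp add: kvs.span_add kvs.span_base)
      qed
    qed (use kv int fin in auto)
  qed
  moreover have "quot_dim (A \<inter> forms i) (A \<inter> B \<inter> forms i) + kvs.dim (A \<inter> B \<inter> forms i)
      = kvs.dim (A \<inter> forms i)"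
    by (rule quot_dim_forms_add[where d = i])
      (use kv int kvs.subspace_inter in auto)
  moreover have "quot_dim (?K \<inter> forms i) (B \<inter> forms i) + kvs.dim (B \<inter> forms i)
      = kvs.dim (?K \<inter> forms i)"
    by (rule quot_dim_forms_add[where d = i])
      (use kv int rmod.span_superset[of "A \<union> B"] in auto)
  moreover have "h_vector X i + kvs.dim (X \<inter> forms i) = kvs.dim (forms i :: ('v, 'k) mpoly set)"
    if "kvs.subspace X" for X :: "('v, 'k) mpoly set"
    unfolding h_vector_def
    by (rule quot_dim_forms_add[OF int[OF that] _ subspace_forms order_refl]) simp
  note this[OF kv(1)] this[OF kv(2)] this[OF kv(3)] this[OF kvs.subspace_inter[OF kv(1,2)]]
  ultimately show "h_vector ?K i + h_vector (A \<inter> B) i = h_vector A i + h_vector B i"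
    by linarith
qed

text \<open>
  The module \<open>\<langle>F, G\<rangle> / \<langle>G\<rangle>\<close> is cyclic, generated by the class of \<open>F\<close> in degree \<open>e\<close>, so the reverse
  of its Hilbert function is that of \<open>R\<close> modulo the annihilator of this class.
\<close>

lemma h_vector_colon:
  fixes F G :: "('v::finite, 'k::field_char_0) mpoly"
  assumes F: "F \<in> forms e" and G: "G \<in> forms e" and i: "i \<le> e"
  shows "h_vector {p. diff_act p F \<in> dmod.span {G}} i + kvs.dim (dmod.span {G} \<inter> forms (e - i))
      = kvs.dim (dmod.span {F, G} \<inter> forms (e - i))"
proof -
  let ?J = "{p. diff_act p F \<in> dmod.span {G}}"
  let ?V = "dmod.span {F, G} \<inter> forms (e - i)" and ?W = "dmod.span {G} \<inter> forms (e - i)"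
  have GFG: "dmod.span {G} \<subseteq> dmod.span {F, G}" by (rule dmod.span_mono) simp
  have "kvs.subspace (dmod.span N)" for N :: "('v, 'k) mpoly set"
    by (rule dmod_kvs_subspace) simp
  note sub = kvs.subspace_inter[OF this subspace_forms]
  have "quot_dim (forms i) {p \<in> forms i. diff_act p F \<in> ?W} = quot_dim ?V ?W"
  proof (rule quot_dim_preimage[where X = "monomial ` {m. mdeg m = i}"
        and Y = "monomial ` {m. mdeg m = e - i}"])
    show "(\<lambda>p. diff_act p F) ` forms i \<subseteq> ?V"
      using diff_act_in_forms(1)[OF _ F] dmod.span_scale[OF dmod.span_base, of F "{F, G}"]
      by auto
    \<comment> \<open>Surjectivity: in degree e - i, the contribution of G lies in \<open>?W\<close>
      and that of F is the image of a form of degree i.\<close>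
    show "?V \<subseteq> kvs.span ((\<lambda>p. diff_act p F) ` forms i \<union> ?W)"
    proof
      fix x assume x: "x \<in> ?V"
      then obtain p q where "x = diff_act p F + diff_act q G" by (auto simp: mem_span_pair)
      then have "x = hom_part (e - i) (diff_act p F) + hom_part (e - i) (diff_act q G)"
        using x hom_part_form[of x "e - i" "e - i"] by (simp add: hom_part_add)
      moreover have "hom_part (e - i) (diff_act p F) = diff_act (hom_part i p) F"
        using i by (simp add: hom_part_diff_act[OF F])
      moreover have "hom_part (e - i) (diff_act q G) \<in> ?W"
        using graded_submoduleD[OF graded_span_singleton[OF G] diff_act_in_span] hom_part_in_forms
        by blast
      moreover have "diff_act (hom_part i p) F \<in> (\<lambda>p. diff_act p F) ` forms i"
        using hom_part_in_forms by blast
      ultimately show "x \<in> kvs.span ((\<lambda>p. diff_act p F) ` forms i \<union> ?W)"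
        using kvs.span_add[OF kvs.span_base kvs.span_base, of "diff_act (hom_part i p) F" _
            "hom_part (e - i) (diff_act q G)"] by simp
    qed
    show "?V \<subseteq> kvs.span (monomial ` {m. mdeg m = e - i})"
      using forms_subset_span by blast
    show "?W \<subseteq> ?V" using GFG by blast
  qed (intro sub linear_diff_act subspace_forms finite_imageI finite_monomials forms_subset_span)+
  moreover have "{p \<in> forms i. diff_act p F \<in> ?W} = ?J \<inter> forms i"
    using diff_act_in_forms(1)[OF _ F] by blast
  moreover have "quot_dim ?V ?W + kvs.dim ?W = kvs.dim ?V"
    by (rule quot_dim_forms_add[where d = "e - i"]) (use GFG sub in auto)
  ultimately show ?thesis by (simp add: h_vector_def)
qed

lemma h_vector_colon_high:
  assumes F: "F \<in> forms e" and i: "e < i"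
  shows "h_vector {p. diff_act p F \<in> dmod.span {G}} i = 0"
  by (rule h_vector_0_if_forms_subset)
    (use diff_act_in_forms(2)[OF _ F i] in \<open>auto simp: dmod.span_zero\<close>)

text \<open>1 lies in the colon ideal only if F lies in the module generated by G, whose degree e
  part is the line spanned by G.\<close>

lemma colon_O_sequence:
  assumes F: "F \<in> forms e" and G: "G \<in> forms e" and FG: "F \<notin> kvs.span {G}"
  shows "O_sequence (h_vector {p. diff_act p F \<in> dmod.span {G}})"
proof (rule macaulay_O_sequence)
  show "rmod.subspace {p. diff_act p F \<in> dmod.span {G}}"
    using homogeneous_preimage[OF F graded_span_singleton[OF G]]
    by (simp add: homogeneous_ideal_def)
  show "1 \<notin> {p. diff_act p F \<in> dmod.span {G}}"
    using FG F span_singleton_top[OF G] by auto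
qed

text \<open>A generator of degree above e is zero, since the module vanishes there, and one of
  degree below e contributes nothing in degree e. So the generators of degree exactly e span the
  two-dimensional top part: both have degree e, and neither is a multiple of the other.\<close>

lemma generators_top_degree:
  fixes F G :: "('v::finite, 'k::field_char_0) mpoly"
  assumes F: "F \<in> forms a" and G: "G \<in> forms b"
    and top: "kvs.dim (dmod.span {F, G} \<inter> forms e) = 2"
    and high: "\<And>i. e < i \<Longrightarrow> kvs.dim (dmod.span {F, G} \<inter> forms i) = 0"
  shows "a = e" "b = e" "F \<notin> kvs.span {G}" "G \<notin> kvs.span {F}"
proof -
  let ?M = "dmod.span {F, G}"
  have top_part: "hom_part e (diff_act p X) \<in> kvs.span (if c = e then {X} else {})"
    if X: "X \<in> forms c" "X \<in> ?M" for X p c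
  proof -
    have "X = 0" if "e < c"
    proof -
      have "kvs.subspace (?M \<inter> forms c)"
        by (rule kvs.subspace_inter[OF dmod_kvs_subspace subspace_forms]) simp
      moreover have "?M \<inter> forms c \<subseteq> kvs.span (monomial ` {m. mdeg m = c})"
        using forms_subset_span by blast
      moreover have "kvs.dim {0} = kvs.dim (?M \<inter> forms c)"
        using high[OF that] dim_zero by simp
      ultimately have "{0} = ?M \<inter> forms c"
        using dim_subspace_le(2)[of "{0}" "?M \<inter> forms c", OF _ _ _ finite_imageI[OF finite_monomials]]
          kvs.subspace_0 by fastforce
      then show ?thesis using X by blast
    qed
    then consider "X = 0" | "c < e" | "c = e" by linarith
    then show ?thesis
    proof cases
      case 3
      then show ?thesis
        using hom_part_diff_act[OF X(1), of e p]
        by (simp add: hom_part_0 diff_act_const kvs.span_scale kvs.span_base)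
    qed (use hom_part_diff_act[OF X(1), of e p] kvs.span_zero in auto)
  qed
  define B where "B = (if a = e then {F} else {}) \<union> (if b = e then {G} else {})"
  have "?M \<inter> forms e \<subseteq> kvs.span B"
  proof
    fix x assume x: "x \<in> ?M \<inter> forms e"
    then obtain p q where "x = diff_act p F + diff_act q G" by (auto simp: mem_span_pair)
    then have "x = hom_part e (diff_act p F) + hom_part e (diff_act q G)"
      using x hom_part_form[of x e e] by (simp add: hom_part_add)
    then show "x \<in> kvs.span B"
      using top_part[OF F dmod.span_base, of p] top_part[OF G dmod.span_base, of q]
      unfolding B_def kvs.span_Un by blast
  qed
  moreover have two: "2 \<le> card Y" if "?M \<inter> forms e \<subseteq> kvs.span Y" "finite Y" for Y
    using kvs.dim_le_card[OF that] top by simp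
  moreover have "finite B" by (simp add: B_def)
  ultimately have spB: "?M \<inter> forms e \<subseteq> kvs.span B" and "2 \<le> card B" by blast+
  then show ab: "a = e" "b = e"
    by (auto simp: B_def card_insert_if split: if_splits)
  then have B: "B = {F, G}" by (auto simp: B_def)
  show "F \<notin> kvs.span {G}"
  proof
    assume "F \<in> kvs.span {G}"
    then have "kvs.span B = kvs.span {G}" unfolding B by (rule kvs.span_redundant)
    then show False using two[of "{G}"] spB by simp
  qed
  show "G \<notin> kvs.span {F}"
  proof
    assume "G \<in> kvs.span {F}"
    then have "kvs.span B = kvs.span {F}" unfolding B insert_commute[of F] by (rule kvs.span_redundant)
    then show False using two[of "{F}"] spB by simp
  qed
qed

text \<open>The annihilator of a nonzero form is homogeneous, so a nonzero constant term of an
  element would annihilate the form by itself; hence all elements of the sum have constant term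
  0.\<close>

lemma one_notin_sum_ann:
  assumes "F \<in> forms a" "G \<in> forms b" "F \<noteq> 0" "G \<noteq> 0"
  shows "1 \<notin> rmod.span (ann (dmod.span {F}) \<union> ann (dmod.span {G}))"
proof
  have hom: "homogeneous_ideal (ann (dmod.span {F}))" "homogeneous_ideal (ann (dmod.span {G}))"
    using assms homogeneous_ann by blast+
  have zero: "Poly_Mapping.lookup p 0 = 0"
    if "p \<in> ann (dmod.span {X})" "homogeneous_ideal (ann (dmod.span {X}))" "X \<noteq> 0" for p X
  proof -
    have "hom_part 0 p \<in> ann (dmod.span {X})"
      using that by (simp add: homogeneous_ideal_def)
    then have "scalar_mult (Poly_Mapping.lookup p 0) X = 0"
      by (simp add: ann_span_singleton hom_part_0 diff_act_const)
    then show ?thesis using that(3) by simp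
  qed
  assume "1 \<in> rmod.span (ann (dmod.span {F}) \<union> ann (dmod.span {G}))"
  moreover have "rmod.span (ann (dmod.span {F})) = ann (dmod.span {F})"
    "rmod.span (ann (dmod.span {G})) = ann (dmod.span {G})"
    using hom by (simp_all add: homogeneous_ideal_def)
  ultimately obtain p q where
    pq: "1 = p + q" "p \<in> ann (dmod.span {F})" "q \<in> ann (dmod.span {G})"
    unfolding rmod.span_Un by auto
  have "Poly_Mapping.lookup (p + q) 0 = 0"
    using zero[OF pq(2) hom(1) assms(3)] zero[OF pq(3) hom(2) assms(4)] by (simp add: lookup_add)
  then show False by (simp flip: pq(1))
qed

lemma ann_span_pair: "ann (dmod.span {F, G}) = ann (dmod.span {F}) \<inter> ann (dmod.span {G})"
proof
  show "ann (dmod.span {F, G}) \<subseteq> ann (dmod.span {F}) \<inter> ann (dmod.span {G})"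
    using dmod.span_mono[of "{F}" "{F, G}"] dmod.span_mono[of "{G}" "{F, G}"]
    by (auto simp: ann_def)
  show "ann (dmod.span {F}) \<inter> ann (dmod.span {G}) \<subseteq> ann (dmod.span {F, G})"
  proof
    fix t assume t: "t \<in> ann (dmod.span {F}) \<inter> ann (dmod.span {G})"
    have "diff_act t (diff_act p F + diff_act q G) = 0" for p q
      using t diff_act_in_span[of p F] diff_act_in_span[of q G]
      by (simp only: diff_act_add_right ann_def Int_iff mem_Collect_eq) simp
    then show "t \<in> ann (dmod.span {F, G})"
      by (auto simp only: ann_def mem_span_pair)
  qed
qed

section \<open>The decomposition of h\<close>

lemma reverse_reverse: "(\<And>i. e < i \<Longrightarrow> v i = 0) \<Longrightarrow> reverse e (reverse e v) = v"
  by (auto simp: reverse_def fun_eq_iff)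

theorem theorem2p3:
  fixes I M :: "('v::finite, 'k::field_char_0) mpoly set"
    and F G :: "('v, 'k) mpoly"
    and h :: "nat \<Rightarrow> nat" and e a b :: nat
  assumes level: "level_algebra I e 2"
    and no_linear_forms: "\<forall>p\<in>I \<inter> forms 1. p = 0"
    and h: "h = h_vector I"
    and M: "M = inverse_system I"
    and forms: "F \<in> forms a" "G \<in> forms b"
    and generate: "dmod.span {F, G} = M"
  shows "\<exists>h' h'' h'''.
           (\<forall>i>e. h' i = 0 \<and> h'' i = 0 \<and> h''' i = 0) \<and>
           (\<forall>i\<le>e. h i = h' i + h'' i + h''' i) \<and>
           O_sequence h'' \<and> O_sequence (reverse e h') \<and> O_sequence (reverse e h''') \<and>
           gorenstein (ann (dmod.span {F})) \<and>
           (\<forall>i. h' i + h'' i = h_vector (ann (dmod.span {F})) i) \<and>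
           gorenstein (ann (dmod.span {G})) \<and>
           (\<forall>i. h'' i + h''' i = h_vector (ann (dmod.span {G})) i) \<and>
           (\<forall>v\<in>{h'', reverse e h', reverse e h'''}.
              \<exists>J. homogeneous_ideal J \<and> I \<subseteq> J \<and> v = h_vector J)"
proof -
  have hom: "homogeneous_ideal I" and sub: "rmod.subspace I"
    and h_high: "\<And>i. e < i \<Longrightarrow> h i = 0"
    using level by (auto simp: level_algebra_def homogeneous_ideal_def socle_degree_def h)
  have dim_M: "h i = kvs.dim (dmod.span {F, G} \<inter> forms i)" for i
    using h_vector_inverse_system[OF hom] by (simp add: h M generate)
  have "forms (Suc e) \<subseteq> I"
    using h_vector_eq_0[OF ideal_kvs_subspace[OF sub]] h_high[of "Suc e"] by (simp add: h)
  \<comment> \<open>I contains all forms of degree Suc e, so every form of degree e represents a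
    socle element and h e is the type.\<close>
  then have "h e = 2"
    using socle_vector_top[OF sub] level by (simp add: level_algebra_def h)
  then have ab: "a = e" "b = e" and FG: "F \<notin> kvs.span {G}" "G \<notin> kvs.span {F}"
    using generators_top_degree[OF forms, of e] h_high by (auto simp flip: dim_M)
  have F: "F \<in> forms e" "F \<noteq> 0" and G: "G \<in> forms e" "G \<noteq> 0"
    using forms ab FG kvs.span_zero by auto
  let ?AF = "ann (dmod.span {F})" and ?AG = "ann (dmod.span {G})"
  let ?JF = "{p. diff_act p F \<in> dmod.span {G}}" and ?JG = "{p. diff_act p G \<in> dmod.span {F}}"
  let ?K = "rmod.span (?AF \<union> ?AG)"
  have "F \<in> M" "G \<in> M" using generate dmod.span_base[of _ "{F, G}"] by auto
  then have IF: "I \<subseteq> ?AF" and IG: "I \<subseteq> ?AG"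
    by (auto simp: M inverse_system_def ann_span_singleton)
  have homF: "homogeneous_ideal ?AF" and homG: "homogeneous_ideal ?AG"
    using F(1) G(1) by (simp_all add: homogeneous_ann)
  have hI: "h i = h_vector (?AF \<inter> ?AG) i" for i
    using h_vector_ann[OF graded_span_pair[OF F(1) G(1)]] by (simp add: dim_M ann_span_pair)
  \<comment> \<open>All three are Hilbert functions up to reversal, so the decomposition reduces to
    the additive identities \<open>sum\<close>, \<open>left\<close> and
    \<open>right\<close>.\<close>
  define h' where "h' = reverse e (h_vector ?JF)"
  define h'' where "h'' = h_vector ?K"
  define h''' where "h''' = reverse e (h_vector ?JG)"
  have rev: "reverse e h' = h_vector ?JF" "reverse e h''' = h_vector ?JG"
    unfolding h'_def h'''_def
    using h_vector_colon_high[OF F(1)] h_vector_colon_high[OF G(1)] by (simp_all add: reverse_reverse)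
  have sum: "h'' i + h i = h_vector ?AF i + h_vector ?AG i" for i
    unfolding h''_def hI by (rule h_vector_sum_ideal(2)[OF homF homG])
  have left: "h' i + h_vector ?AG i = h i" if "i \<le> e" for i
    using h_vector_colon[OF F(1) G(1), of "e - i"] that
    by (simp add: h'_def reverse_def dim_M h_vector_ann[OF graded_span_singleton[OF G(1)]])
  have right: "h''' i + h_vector ?AF i = h i" if "i \<le> e" for i
    using h_vector_colon[OF G(1) F(1), of "e - i"] that
    by (simp add: h'''_def reverse_def dim_M insert_commute
        h_vector_ann[OF graded_span_singleton[OF F(1)]])
  have high: "h_vector (ann (dmod.span {X})) i = 0" if "X \<in> forms e" "e < i" for X i
    using forms_subset_ann[OF that] by (rule h_vector_0_if_forms_subset)
  show ?thesis
  proof (rule exI[of _ h'], rule exI[of _ h''], rule exI[of _ h'''], intro conjI)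
    \<comment> \<open>Above e the Hilbert functions of both annihilators vanish, and
      \<open>sum\<close> forces h'' to vanish too; the other two are 0 there by the default value of
      \<open>reverse\<close>.\<close>
    have gt: "h' i = 0 \<and> h'' i = 0 \<and> h''' i = 0" if "e < i" for i
      using sum[of i] high[OF F(1) that] high[OF G(1) that] that
      by (simp add: h'_def h'''_def reverse_def)
    then show "\<forall>i>e. h' i = 0 \<and> h'' i = 0 \<and> h''' i = 0" by blast
    show "\<forall>i\<le>e. h i = h' i + h'' i + h''' i"
    proof (intro allI impI)
      fix i assume "i \<le> e"
      then show "h i = h' i + h'' i + h''' i" using sum[of i] left[of i] right[of i] by linarith
    qed
    have "h' i + h'' i = h_vector ?AF i \<and> h'' i + h''' i = h_vector ?AG i" for i
    proof (cases "i \<le> e")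
      case True
      then show ?thesis using sum[of i] left[of i] right[of i] by linarith
    next
      case False
      then show ?thesis using gt[of i] high[OF F(1), of i] high[OF G(1), of i] by simp
    qed
    then show "\<forall>i. h' i + h'' i = h_vector ?AF i" "\<forall>i. h'' i + h''' i = h_vector ?AG i" by blast+
    show "gorenstein ?AF" "gorenstein ?AG" using F G by (simp_all add: gorenstein_ann)
    show "O_sequence h''"
      unfolding h''_def
      by (rule macaulay_O_sequence[OF _ one_notin_sum_ann[OF F(1) G(1) F(2) G(2)]]) simp
    show "O_sequence (reverse e h')" "O_sequence (reverse e h''')"
      unfolding rev using colon_O_sequence F(1) G(1) FG by blast+
    have "I \<subseteq> ?JF" "I \<subseteq> ?JG"
      using IF IG by (auto simp: ann_span_singleton dmod.span_zero)
    moreover have "I \<subseteq> ?K" using IF rmod.span_superset[of "?AF \<union> ?AG"] by blast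
    moreover have "homogeneous_ideal ?JF" "homogeneous_ideal ?JG" "homogeneous_ideal ?K"
      using homogeneous_preimage graded_span_singleton F(1) G(1) h_vector_sum_ideal(1) homF homG
      by blast+
    ultimately show "\<forall>v\<in>{h'', reverse e h', reverse e h'''}.
        \<exists>J. homogeneous_ideal J \<and> I \<subseteq> J \<and> v = h_vector J"
      unfolding rev h''_def by blast
  qed
qed

end
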